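(* Let $C,C_1,C_2,\ldots$ be bivariate Extreme Value copulas with Pickands dependence functions $A,A_1,A_2,\ldots$, respectively. Then the following assertions are equivalent: (a) $\lim_{n\to\infty}C_n(x,y)=C(x,y)$ for all $x,y\in[0,1]$; (b) $\lim_{n\to\infty}A_n(x)=A(x)$ for all $x\in[0,1]$; (c) $\lim_{n\to\infty}D^+A_n(x)=D^+A(x)$ for all $x\in\mathrm{Cont}(D^+A)$; (d) $\lim_{n\to\infty}D_1(C_n,C)=0$; (e) $C_n\xrightarrow{\mathrm{wcc}}C$ for $n\to\infty$.
   Context: A Pickands dependence function is a convex map $A:[0,1]\to[0,1]$ with $A(0)=A(1)=1$ and $\max(1-x,x)\le A(x)\le1$ for all $x\in[0,1]$. A bivariate copula $C$ is an Extreme Value copula with Pickands dependence function $A$ if $C(x,y)=C_A(x,y):=(xy)^{A\left(\frac{\ln(x)}{\ln(xy)}\right)}$ for all $x,y\in(0,1)$. $D^+A$ denotes the right-hand derivative of $A$ on $[0,1)$ and $\mathrm{Cont}(D^+A)$ denotes the set of all continuity points of $D^+A$ in $(0,1)$. $\lambda$ denotes the Lebesgue measure on $[0,1]$. For a copula $C$, $K_C:[0,1]\times\mathcal{B}([0,1])\to[0,1]$ denotes (a version of) its Markov kernel, i.e. the regular conditional distribution of $Y$ given $X$ where $(X,Y)$ has distribution function $C$; it is unique for $\lambda$-a.e. $x$. The metric $D_1$ on the family of all bivariate copulas is $$D_1(B_1,B_2)=\int_{[0,1]}\int_{[0,1]}|K_{B_1}(x,[0,y])-K_{B_2}(x,[0,y])|\,d\lambda(x)\,d\lambda(y).$$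 Weak conditional convergence $C_n\xrightarrow{\mathrm{wcc}}C$ means: for $\lambda$-almost every $x\in[0,1]$ the probability measures $K_{C_n}(x,\cdot)$ on $\mathcal{B}([0,1])$ converge weakly to $K_C(x,\cdot)$. *)

theory Defs
  imports "HOL-Probability.Probability"
begin

text \<open>Functions on \<open>[0,1]\<close> or \<open>[0,1]\<^sup>2\<close> are total functions on the reals; only their values
  on the unit interval or square are constrained or used.\<close>

definition is_copula :: "(real \<Rightarrow> real \<Rightarrow> real) \<Rightarrow> bool" where
  "is_copula C \<longleftrightarrow>
     (\<forall>t\<in>{0..1}. C t 0 = 0 \<and> C 0 t = 0 \<and> C t 1 = t \<and> C 1 t = t) \<and>
     (\<forall>x1\<in>{0..1}. \<forall>x2\<in>{0..1}. \<forall>y1\<in>{0..1}. \<forall>y2\<in>{0..1}. x1 \<le> x2 \<longrightarrow> y1 \<le> y2 \<longrightarrow>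
        C x2 y2 - C x1 y2 - C x2 y1 + C x1 y1 \<ge> 0)"

definition pickands :: "(real \<Rightarrow> real) \<Rightarrow> bool" where
  "pickands A \<longleftrightarrow> convex_on {0..1} A \<and> A 0 = 1 \<and> A 1 = 1 \<and>
     (\<forall>x\<in>{0..1}. max (1 - x) x \<le> A x \<and> A x \<le> 1)"

definition extreme_value_copula :: "(real \<Rightarrow> real \<Rightarrow> real) \<Rightarrow> (real \<Rightarrow> real) \<Rightarrow> bool" where
  "extreme_value_copula C A \<longleftrightarrow> is_copula C \<and> pickands A \<and>
     (\<forall>x\<in>{0<..<1}. \<forall>y\<in>{0<..<1}. C x y = (x * y) powr A (ln x / ln (x * y)))"

definition right_deriv :: "(real \<Rightarrow> real) \<Rightarrow> real \<Rightarrow> real" where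
  "right_deriv f x = vector_derivative f (at_right x)"

definition cont_points_right_deriv :: "(real \<Rightarrow> real) \<Rightarrow> real set" where
  "cont_points_right_deriv A = {x\<in>{0<..<1}. isCont (right_deriv A) x}"

abbreviation borel_unit :: "real measure" where
  "borel_unit \<equiv> restrict_space borel {0..1}"

abbreviation lebesgue_unit :: "real measure" where
  "lebesgue_unit \<equiv> restrict_space lborel {0..1}"

definition regular_cond_distr ::
    "'a measure \<Rightarrow> ('a \<Rightarrow> real) \<Rightarrow> ('a \<Rightarrow> real) \<Rightarrow> (real \<Rightarrow> real measure) \<Rightarrow> bool" where
  "regular_cond_distr M X Y K \<longleftrightarrow>
     K \<in> measurable borel_unit (prob_algebra borel_unit) \<and>
     (\<forall>B\<in>sets borel_unit. AE \<omega> in M. measure (K (X \<omega>)) B =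
        real_cond_exp M (vimage_algebra (space M) X borel_unit) (\<lambda>\<omega>. indicator B (Y \<omega>)) \<omega>)"

definition copula_measure :: "(real \<Rightarrow> real \<Rightarrow> real) \<Rightarrow> (real \<times> real) measure \<Rightarrow> bool" where
  "copula_measure C \<mu> \<longleftrightarrow> prob_space \<mu> \<and> sets \<mu> = sets (borel_unit \<Otimes>\<^sub>M borel_unit) \<and>
     (\<forall>x\<in>{0..1}. \<forall>y\<in>{0..1}. measure \<mu> ({0..x} \<times> {0..y}) = C x y)"

definition is_markov_kernel :: "(real \<Rightarrow> real \<Rightarrow> real) \<Rightarrow> (real \<Rightarrow> real measure) \<Rightarrow> bool" where
  "is_markov_kernel C K \<longleftrightarrow> (\<exists>\<mu>. copula_measure C \<mu> \<and> regular_cond_distr \<mu> fst snd K)"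

text \<open>An arbitrary version; every copula has one, and any two agree for almost every \<open>x\<close>.\<close>

definition markov_kernel :: "(real \<Rightarrow> real \<Rightarrow> real) \<Rightarrow> real \<Rightarrow> real measure" where
  "markov_kernel C = (SOME K. is_markov_kernel C K)"

definition D1 :: "(real \<Rightarrow> real \<Rightarrow> real) \<Rightarrow> (real \<Rightarrow> real \<Rightarrow> real) \<Rightarrow> real" where
  "D1 B1 B2 = (LINT y|lebesgue_unit. LINT x|lebesgue_unit.
     \<bar>measure (markov_kernel B1 x) {0..y} - measure (markov_kernel B2 x) {0..y}\<bar>)"

text \<open>The kernels are measures on the Borel sets of \<open>[0,1]\<close>. They are pushed forward to the
  real line because \<^const>\<open>weak_conv_m\<close> evaluates them on half-lines, which are not subsets
  of \<open>[0,1]\<close> and would all get measure \<open>0\<close>. As \<open>[0,1]\<close> is closed in the real line, this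
  does not change the notion of weak convergence.\<close>

definition weak_cond_conv ::
    "(nat \<Rightarrow> real \<Rightarrow> real \<Rightarrow> real) \<Rightarrow> (real \<Rightarrow> real \<Rightarrow> real) \<Rightarrow> bool" where
  "weak_cond_conv Cn C \<longleftrightarrow>
     (AE x in lebesgue_unit.
        weak_conv_m (\<lambda>n. distr (markov_kernel (Cn n) x) borel (\<lambda>t. t))
                    (distr (markov_kernel C x) borel (\<lambda>t. t)))"

end

theory Submission
  imports Defs
begin

text \<open>
  Two observations carry the proof.

  First, everything about an extreme value copula is explicit. Differentiating
  \<open>C x y = (x * y) powr A (ln x / ln (x * y))\<close> in \<open>x\<close> gives, with \<open>t = ln x / ln (x * y)\<close>,
  the conditional distribution function
  \<open>ev_cond_cdf A x y = C x y / x * (A t + (1 - t) * right_deriv A t)\<close>.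
  Since \<open>t\<close> decreases in \<open>x\<close>, this is the left derivative of the copula at every point of the open
  square, and since \<open>t\<close> increases in \<open>y\<close>, it is a right continuous distribution function in \<open>y\<close>.
  Lipschitz functions are integrals of their one-sided derivatives
  (\<open>lipschitz_integral_of_difference_quotient_limit\<close>), so these distribution functions integrate to
  the copula. By the characterisation of Markov kernels in \<open>markov_kernel_integral\<close> and
  \<open>is_markov_kernelI\<close> they therefore form a Markov kernel, and any other version, in particular the
  chosen one, agrees with it for almost every \<open>x\<close> (\<open>AE_markov_kernel_cdf\<close>).

  Second, convexity ties the dependence functions to their right derivatives: pointwise convergence
  of the former forces convergence of the latter at continuity points by comparison with chord
  slopes, and the converse holds by integration, as there are only countably many discontinuities.

  Given this, convergence of the dependence functions is equivalent to convergence of the copulas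
  by taking logarithms. It implies convergence of \<open>ev_cond_cdf\<close> at \<open>(x, y)\<close> whenever \<open>t\<close> is a
  continuity point of the limiting right derivative. For fixed \<open>x\<close> these are precisely the \<open>y\<close> in \<open>(0,1)\<close> at
  which the limiting conditional distribution function is continuous
  (\<open>isCont_ev_cond_cdf_iff\<close>), which is weak conditional convergence; for fixed \<open>y\<close> they exclude only
  countably many \<open>x\<close> (\<open>countable_ev_cond_cdf_discontinuities\<close>), which gives convergence in \<open>D1\<close> by
  dominated convergence. Conversely, integrating the conditional distribution functions returns the
  copulas: under weak conditional convergence by dominated convergence, and under convergence in
  \<open>D1\<close> because functions with a common Lipschitz constant that converge in mean converge pointwise.
\<close>

section \<open>Integrating one-sided derivatives\<close>

text \<open>A fundamental theorem of calculus for one-sided derivatives: it suffices that the difference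
  quotients converge along one null sequence of increments, which may be of either sign. The
  integrals of the quotients are differences of quotients of an antiderivative of \<open>f\<close>, hence
  converge to \<open>f b - f a\<close>, while the Lipschitz bound dominates the quotients.\<close>
lemma lipschitz_integral_of_difference_quotient_limit:
  fixes f g :: "real \<Rightarrow> real" and h :: "nat \<Rightarrow> real"
  assumes ab: "a \<le> b"
    and lip: "\<And>x y. x \<in> {a..b} \<Longrightarrow> y \<in> {a..b} \<Longrightarrow> \<bar>f x - f y\<bar> \<le> L * \<bar>x - y\<bar>"
    and h0: "h \<longlonglongrightarrow> 0" and hn: "\<And>n. h n \<noteq> 0"
    and quot: "\<And>x. x \<in> {a<..<b} \<Longrightarrow> (\<lambda>n. (f (x + h n) - f x) / h n) \<longlonglongrightarrow> g x"
  shows "integrable lborel (\<lambda>x. indicator {a<..<b} x * g x)"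
    and "(LINT x|lborel. indicator {a<..<b} x * g x) = f b - f a"
proof -
  define k where "k x = f (max a (min b x))" for x
  \<comment> \<open>\<open>k\<close> extends \<open>f\<close> constantly beyond both ends, so that shifts leaving the interval make sense.\<close>
  have klip: "\<bar>k x - k y\<bar> \<le> \<bar>L\<bar> * \<bar>x - y\<bar>" for x y
  proof -
    have "\<bar>k x - k y\<bar> \<le> L * \<bar>max a (min b x) - max a (min b y)\<bar>"
      unfolding k_def using ab by (intro lip) auto
    also have "\<dots> \<le> \<bar>L\<bar> * \<bar>x - y\<bar>" by (intro mult_mono) auto
    finally show ?thesis .
  qed
  have kcont: "continuous_on UNIV k"
  proof (rule continuous_onI)
    fix x e :: real assume e: "e > 0"
    have "dist (k y) (k x) \<le> e" if "dist y x < e / (\<bar>L\<bar> + 1)" for y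
    proof -
      have "dist (k y) (k x) \<le> (\<bar>L\<bar> + 1) * dist y x"
        using klip[of y x] by (simp add: dist_real_def algebra_simps)
      also have "\<dots> \<le> (\<bar>L\<bar> + 1) * (e / (\<bar>L\<bar> + 1))" using that by (intro mult_left_mono) auto
      finally show ?thesis by simp
    qed
    then show "\<exists>d>0. \<forall>x'\<in>UNIV. dist x' x < d \<longrightarrow> dist (k x') (k x) \<le> e"
      using e by (intro exI[of _ "e / (\<bar>L\<bar> + 1)"]) auto
  qed
  \<comment> \<open>The margin of length \<open>1\<close> leaves room for the shifts by \<open>h n\<close> once \<open>\<bar>h n\<bar> < 1\<close>.\<close>
  obtain \<Phi> where \<Phi>': "\<And>x. x \<in> {a - 1..b + 1} \<Longrightarrow> (\<Phi> has_vector_derivative k x) (at x within {a - 1..b + 1})"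
    using antiderivative_continuous[of "a - 1" "b + 1" k] kcont continuous_on_subset by blast
  have \<Phi>: "(\<Phi> has_real_derivative k x) (at x)" if "a - 1 < x" "x < b + 1" for x
    using \<Phi>'[of x] that at_within_interior[of x "{a - 1..b + 1}"]
    by (simp add: has_real_derivative_iff_has_vector_derivative)
  define q where "q n x = (k (x + h n) - k x) / h n" for n x
  have qb: "\<bar>q n x\<bar> \<le> \<bar>L\<bar>" for n x
    using klip[of "x + h n" x] hn[of n] by (simp add: q_def abs_divide divide_le_eq)
  have [measurable]: "k \<in> borel_measurable borel"
    using kcont by (rule borel_measurable_continuous_onI)
  have [measurable]: "q n \<in> borel_measurable borel" for n unfolding q_def by measurable
  have lim: "(\<lambda>n. indicator {a<..<b} x * q n x) \<longlonglongrightarrow> indicator {a<..<b} x * g x" for x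
  proof (cases "x \<in> {a<..<b}")
    case True
    have "(\<lambda>n. x + h n) \<longlonglongrightarrow> x + 0" by (intro tendsto_intros h0)
    then have "eventually (\<lambda>n. x + h n \<in> {a<..<b}) sequentially"
      using True by (intro topological_tendstoD) auto
    then have "eventually (\<lambda>n. (f (x + h n) - f x) / h n = q n x) sequentially"
      by eventually_elim (use True in \<open>auto simp: q_def k_def min_def max_def\<close>)
    with quot[OF True] have "(\<lambda>n. q n x) \<longlonglongrightarrow> g x" by (rule Lim_transform_eventually)
    then show ?thesis by (intro tendsto_intros)
  qed auto
  have gm: "(\<lambda>x. indicator {a<..<b} x * g x) \<in> borel_measurable lborel"
    by (rule borel_measurable_LIMSEQ_real[OF lim]) measurable
  have dom: "integrable lborel (\<lambda>x. indicator {a<..<b} x * \<bar>L\<bar>)"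
    by (intro integrable_mult_left integrable_real_indicator) (simp_all add: ab)
  have bnd: "norm (indicator {a<..<b} x * q n x) \<le> indicator {a<..<b} x * \<bar>L\<bar>" for n x
    using qb[of n x] by (auto simp: indicator_def)
  have qm: "(\<lambda>x. indicator {a<..<b} x * q n x) \<in> borel_measurable lborel" for n by measurable
  show "integrable lborel (\<lambda>x. indicator {a<..<b} x * g x)"
    by (rule integrable_dominated_convergence[where s = "\<lambda>n x. indicator {a<..<b} x * q n x", OF gm qm dom])
      (use lim bnd in auto)
  have conv: "(\<lambda>n. LINT x|lborel. indicator {a<..<b} x * q n x) \<longlonglongrightarrow> (LINT x|lborel. indicator {a<..<b} x * g x)"
    by (rule integral_dominated_convergence[where s = "\<lambda>n x. indicator {a<..<b} x * q n x", OF gm qm dom])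
      (use lim bnd in auto)
  \<comment> \<open>The integral of a difference quotient telescopes to two difference quotients of the antiderivative.\<close>
  have ev: "eventually (\<lambda>n. (\<Phi> (b + h n) - \<Phi> b) / h n - (\<Phi> (a + h n) - \<Phi> a) / h n
      = (LINT x|lborel. indicator {a<..<b} x * q n x)) sequentially"
  proof -
    have "eventually (\<lambda>n. \<bar>h n\<bar> < 1) sequentially"
      using order_tendstoD(2)[OF tendsto_rabs[OF h0], of 1] by simp
    then show ?thesis
    proof eventually_elim
      case (elim n)
      have "(LINT x|lborel. indicator {a<..<b} x * q n x) = (LINT x|lborel. indicator {a..b} x *\<^sub>R q n x)"
      proof (rule integral_cong_AE)
        show "AE x in lborel. indicator {a<..<b} x * q n x = indicator {a..b} x *\<^sub>R q n x"
          using AE_lborel_singleton[of a] AE_lborel_singleton[of b]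
          by eventually_elim (auto simp: indicator_def)
      qed auto
      also have "\<dots> = (\<Phi> (b + h n) - \<Phi> b) / h n - (\<Phi> (a + h n) - \<Phi> a) / h n"
      proof (rule integral_FTC_atLeastAtMost[where F = "\<lambda>x. (\<Phi> (x + h n) - \<Phi> x) / h n", OF ab])
        fix x assume x: "a \<le> x" "x \<le> b"
        have "((\<lambda>x. \<Phi> (x + h n)) has_real_derivative k (x + h n)) (at x)"
          using \<Phi>[of "x + h n"] x elim by (simp add: DERIV_shift)
        then have "((\<lambda>x. (\<Phi> (x + h n) - \<Phi> x) / h n) has_real_derivative q n x) (at x)"
          unfolding q_def using \<Phi>[of x] x by (intro DERIV_cdivide DERIV_diff) auto
        then show "((\<lambda>x. (\<Phi> (x + h n) - \<Phi> x) / h n) has_vector_derivative q n x) (at x within {a..b})"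
          by (simp add: has_real_derivative_iff_has_vector_derivative has_vector_derivative_at_within)
      next
        show "continuous_on {a..b} (q n)" unfolding q_def
          by (intro continuous_intros continuous_on_compose2[OF kcont]) (use hn in auto)
      qed
      finally show ?case by simp
    qed
  qed
  have d: "(\<lambda>n. (\<Phi> (x + h n) - \<Phi> x) / h n) \<longlonglongrightarrow> f x" if "x \<in> {a..b}" for x
  proof -
    have "((\<lambda>t. (\<Phi> (x + t) - \<Phi> x) / t) \<longlongrightarrow> k x) (at 0)"
      using \<Phi>[of x] that by (simp add: DERIV_def)
    moreover have "filterlim h (at 0) sequentially"
      using h0 hn by (auto simp: filterlim_at)
    ultimately have "(\<lambda>n. (\<Phi> (x + h n) - \<Phi> x) / h n) \<longlonglongrightarrow> k x" by (rule filterlim_compose)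
    then show ?thesis using that by (simp add: k_def)
  qed
  have "(\<lambda>n. LINT x|lborel. indicator {a<..<b} x * q n x) \<longlonglongrightarrow> f b - f a"
    by (rule Lim_transform_eventually[OF _ ev]) (intro tendsto_diff d; use ab in auto)
  with conv show "(LINT x|lborel. indicator {a<..<b} x * g x) = f b - f a"
    by (rule LIMSEQ_unique)
qed

section \<open>Markov kernels of copulas\<close>

text \<open>Finite measures on the unit interval are determined by their distribution functions. The
  corresponding fact on the real line carries over by pushing forward along the inclusion.\<close>
lemma measure_eqI_borel_unit:
  assumes sM: "sets M = sets borel_unit" and sN: "sets N = sets borel_unit"
    and "finite_measure M" and "finite_measure N"
    and eq: "\<And>x. x \<in> {0..1} \<Longrightarrow> measure M {0..x} = measure N {0..x}"
  shows "M = N"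
proof -
  interpret M: finite_measure M by fact
  interpret N: finite_measure N by fact
  have sp: "space M = {0..1}" "space N = {0..1}"
    using sets_eq_imp_space_eq[OF sM] sets_eq_imp_space_eq[OF sN] by (auto simp: space_restrict_space)
  have [measurable]: "(\<lambda>t. t) \<in> M \<rightarrow>\<^sub>M borel" "(\<lambda>t. t) \<in> N \<rightarrow>\<^sub>M borel"
    by (auto simp: measurable_cong_sets[OF sM refl] measurable_cong_sets[OF sN refl]
             intro!: measurable_restrict_space1)
  have i0: "{0..x} \<in> sets borel_unit" if "x \<in> {0..1}" for x :: real
    using that by (auto simp: sets_restrict_space image_iff intro!: bexI[of _ "{0..x}"])
  have tail: "measure P ({x<..} \<inter> {0..1}) = (if x < 0 then measure P {0..1} else if 1 < x then 0 else measure P {0..1} - measure P {0..x})"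
    if P: "finite_measure P" "sets P = sets borel_unit" for P and x :: real
  proof -
    interpret P: finite_measure P by fact
    have e: "{x<..} \<inter> {0..1} = (if x < 0 then {0..1} else if 1 < x then {} else {0..1} - {0..x})" by auto
    show ?thesis
    proof (cases "0 \<le> x \<and> x \<le> 1")
      case True
      then have "measure P ({0..1} - {0..x}) = measure P {0..1} - measure P {0..x}"
        using i0 by (intro P.finite_measure_Diff) (auto simp: P(2))
      with True show ?thesis unfolding e by simp
    qed (unfold e, auto)
  qed
  have mt: "measure M ({x<..} \<inter> {0..1}) = measure N ({x<..} \<inter> {0..1})" for x
    using tail[OF assms(3) sM] tail[OF assms(4) sN] eq[of 1] eq[of x] by simp
  \<comment> \<open>On the real line the half-lines \<open>{x<..}\<close> determine a finite measure.\<close>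
  have D: "distr M borel (\<lambda>t. t) = distr N borel (\<lambda>t. t)"
  proof (rule measure_eqI_lessThan)
    fix x :: real
    have "emeasure (distr M borel (\<lambda>t. t)) {x<..} = emeasure M ({x<..} \<inter> {0..1})"
      "emeasure (distr N borel (\<lambda>t. t)) {x<..} = emeasure N ({x<..} \<inter> {0..1})"
      by (auto simp: emeasure_distr sp)
    then show "emeasure (distr M borel (\<lambda>t. t)) {x<..} = emeasure (distr N borel (\<lambda>t. t)) {x<..}"
        "emeasure (distr M borel (\<lambda>t. t)) {x<..} < \<infinity>"
      using mt[of x] M.emeasure_finite N.emeasure_finite
      by (auto simp: M.emeasure_eq_measure N.emeasure_eq_measure)
  qed auto
  show ?thesis
  proof (rule measure_eqI)
    fix S assume "S \<in> sets M"
    then have S: "S \<in> sets borel" "S \<subseteq> {0..1}" unfolding sM by (auto simp: sets_restrict_space_iff)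
    have "emeasure (distr M borel (\<lambda>t. t)) S = emeasure M S" "emeasure (distr N borel (\<lambda>t. t)) S = emeasure N S"
      using S by (auto simp: emeasure_distr sp Int_absorb2)
    then show "emeasure M S = emeasure N S" by (simp add: D)
  qed (simp add: sM sN)
qed

lemma Icc_in_borel_unit: "{0..x} \<in> sets borel_unit" if "x \<le> (1::real)"
  using that by (auto simp: sets_restrict_space_iff)

lemma prob_space_lebesgue_unit: "prob_space lebesgue_unit"
  by (intro prob_spaceI) (simp add: space_restrict_space emeasure_restrict_space)

lemma measure_lebesgue_unit_Icc: "x \<in> {0..1} \<Longrightarrow> measure lebesgue_unit {0..x} = x"
  by (subst measure_restrict_space) auto

lemma measurable_kernel_measure:
  assumes "K \<in> borel_unit \<rightarrow>\<^sub>M prob_algebra borel_unit" and "B \<in> sets borel_unit"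
  shows "(\<lambda>s. measure (K s) B) \<in> borel_measurable borel_unit"
  using measurable_compose[OF measurable_prob_algebraD[OF assms(1)] measurable_measure_subprob_algebra[OF assms(2)]] .

lemma sets_lebesgue_unit: "sets lebesgue_unit = sets borel_unit"
  by (auto simp: sets_restrict_space)

lemma kernel_prob_space:
  assumes "K \<in> borel_unit \<rightarrow>\<^sub>M prob_algebra borel_unit" and "s \<in> {0..1}"
  shows "prob_space (K s)" "sets (K s) = sets borel_unit" "space (K s) = {0..1}"
proof -
  have "K s \<in> space (prob_algebra borel_unit)"
    using assms by (intro measurable_space[OF assms(1)]) (auto simp: space_restrict_space)
  then show "prob_space (K s)" and s: "sets (K s) = sets borel_unit" by (auto simp: space_prob_algebra)
  show "space (K s) = {0..1}" using sets_eq_imp_space_eq[OF s] by (simp add: space_restrict_space)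
qed

text \<open>Kernels take values in probability measures, so these integrands are bounded by \<open>1\<close>.\<close>
lemma integrable_kernel_measure:
  assumes K: "K \<in> borel_unit \<rightarrow>\<^sub>M prob_algebra borel_unit" and B: "B \<in> sets borel_unit"
    and A: "A \<in> sets borel_unit"
  shows "integrable lebesgue_unit (\<lambda>s. indicator A s * measure (K s) B)"
proof -
  interpret prob_space lebesgue_unit by (rule prob_space_lebesgue_unit)
  note [measurable] = measurable_kernel_measure[OF K B] A
  have "(\<lambda>s. indicator A s * measure (K s) B) \<in> borel_measurable borel_unit" by measurable
  then have [measurable]: "(\<lambda>s. indicator A s * measure (K s) B) \<in> borel_measurable lebesgue_unit"
    by (simp add: measurable_cong_sets[OF sets_lebesgue_unit refl])
  show ?thesis
  proof (rule integrable_const_bound[of _ 1])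
    show "AE s in lebesgue_unit. norm (indicator A s * measure (K s) B) \<le> 1"
    proof (rule AE_I2)
      fix s assume "s \<in> space lebesgue_unit"
      then interpret Ks: prob_space "K s" by (intro kernel_prob_space[OF K]) (simp add: space_restrict_space)
      show "norm (indicator A s * measure (K s) B) \<le> 1" by (simp add: indicator_def)
    qed
  qed measurable
qed

lemma subalgebra_vimage:
  assumes "X \<in> M \<rightarrow>\<^sub>M N" shows "subalgebra M (vimage_algebra (space M) X N)"
  using assms measurable_space[OF assms] unfolding subalgebra_def
  by (auto simp: sets_vimage_algebra2 Pi_iff intro: measurable_sets)

text \<open>Together with \<open>is_markov_kernelI\<close> below, this replaces conditional expectations by integrals
  over \<open>[0,1]\<close>: a measurable family of probability measures is a Markov kernel of a copula exactly
  when its distribution functions integrate to the copula. Both directions rest on the first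
  marginal of a copula measure being uniform.\<close>
lemma markov_kernel_integral:
  assumes C: "is_copula C" and "is_markov_kernel C K"
  shows "K \<in> borel_unit \<rightarrow>\<^sub>M prob_algebra borel_unit"
    and "\<And>x y. x \<in> {0..1} \<Longrightarrow> y \<in> {0..1} \<Longrightarrow>
          (LINT s|lebesgue_unit. indicator {0..x} s * measure (K s) {0..y}) = C x y"
proof -
  obtain \<mu> where cm: "copula_measure C \<mu>" and rc: "regular_cond_distr \<mu> fst snd K"
    using assms(2) by (auto simp: is_markov_kernel_def)
  from rc show K: "K \<in> borel_unit \<rightarrow>\<^sub>M prob_algebra borel_unit" by (simp add: regular_cond_distr_def)
  interpret prob_space \<mu> using cm by (simp add: copula_measure_def)
  have sm: "sets \<mu> = sets (borel_unit \<Otimes>\<^sub>M borel_unit)" using cm by (simp add: copula_measure_def)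
  have sp: "space \<mu> = {0..1} \<times> {0..1}"
    using sets_eq_imp_space_eq[OF sm] by (simp add: space_pair_measure space_restrict_space)
  have mC: "measure \<mu> ({0..x} \<times> {0..y}) = C x y" if "x \<in> {0..1}" "y \<in> {0..1}" for x y
    using cm that by (auto simp: copula_measure_def)
  have [measurable]: "fst \<in> \<mu> \<rightarrow>\<^sub>M borel_unit" "snd \<in> \<mu> \<rightarrow>\<^sub>M borel_unit"
    by (simp_all add: measurable_cong_sets[OF sm refl])
  define F where "F = vimage_algebra (space \<mu>) fst borel_unit"
  interpret F: finite_measure_subalgebra \<mu> F
    unfolding F_def by unfold_locales (rule subalgebra_vimage, measurable)
  have marg: "distr \<mu> borel_unit fst = lebesgue_unit"
  proof (rule measure_eqI_borel_unit)
    show "finite_measure (distr \<mu> borel_unit fst)"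
      by (intro finite_measure_distr) measurable
    show "finite_measure lebesgue_unit"
      using prob_space_lebesgue_unit by (simp add: prob_space_def)
    fix x :: real assume x: "x \<in> {0..1}"
    have "measure (distr \<mu> borel_unit fst) {0..x} = measure \<mu> (fst -` {0..x} \<inter> space \<mu>)"
      using x by (intro measure_distr Icc_in_borel_unit) auto
    also have "fst -` {0..x} \<inter> space \<mu> = {0..x} \<times> {0..1}" using x by (auto simp: sp)
    also have "measure \<mu> \<dots> = x" using mC[of x 1] x C by (auto simp: is_copula_def)
    finally show "measure (distr \<mu> borel_unit fst) {0..x} = measure lebesgue_unit {0..x}"
      using x by (simp add: measure_lebesgue_unit_Icc)
  qed (simp_all add: sets_lebesgue_unit)
  fix x y :: real assume x: "x \<in> {0..1}" and y: "y \<in> {0..1}"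
  note [measurable] = Icc_in_borel_unit[of x] Icc_in_borel_unit[of y]
    measurable_kernel_measure[OF K Icc_in_borel_unit[of y]]
  define S where "S = fst -` {0..x} \<inter> space \<mu>"
  have SF: "S \<in> sets F" unfolding S_def F_def using x
    by (intro in_vimage_algebra Icc_in_borel_unit) auto
  then have SM[measurable]: "S \<in> sets \<mu>" using F.subalg by (auto simp: subalgebra_def)
  have int: "integrable \<mu> (\<lambda>\<omega>. indicator {0..y} (snd \<omega>) :: real)"
  proof (rule integrable_const_bound[of _ 1])
    show "(\<lambda>\<omega>. indicator {0..y} (snd \<omega>) :: real) \<in> borel_measurable \<mu>" using y by simp
  qed (simp add: indicator_def)
  have cmeas: "real_cond_exp \<mu> F (\<lambda>\<omega>. indicator {0..y} (snd \<omega>)) \<in> borel_measurable \<mu>"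
    by (rule borel_measurable_cond_exp2)
  \<comment> \<open>Transfer to \<open>\<mu>\<close> along the first coordinate, exchange the kernel for the conditional expectation, and use the defining property of the latter on the cylinder \<open>S\<close>.\<close>
  have "(LINT s|lebesgue_unit. indicator {0..x} s * measure (K s) {0..y}) =
      (LINT \<omega>|\<mu>. indicator {0..x} (fst \<omega>) * measure (K (fst \<omega>)) {0..y})"
    unfolding marg[symmetric] using x y by (intro integral_distr) auto
  also have "\<dots> = (LINT \<omega>|\<mu>. indicator S \<omega> *\<^sub>R real_cond_exp \<mu> F (\<lambda>\<omega>. indicator {0..y} (snd \<omega>)) \<omega>)"
  proof (rule integral_cong_AE)
    have "AE \<omega> in \<mu>. measure (K (fst \<omega>)) {0..y} = real_cond_exp \<mu> F (\<lambda>\<omega>. indicator {0..y} (snd \<omega>)) \<omega>"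
      using rc Icc_in_borel_unit[of y] y by (auto simp: regular_cond_distr_def F_def)
    then show "AE \<omega> in \<mu>. indicator {0..x} (fst \<omega>) * measure (K (fst \<omega>)) {0..y}
        = indicator S \<omega> *\<^sub>R real_cond_exp \<mu> F (\<lambda>\<omega>. indicator {0..y} (snd \<omega>)) \<omega>"
      using AE_space by eventually_elim (auto simp: S_def indicator_def)
  qed (use x y cmeas in auto)
  also have "\<dots> = (LINT \<omega>|\<mu>. indicator S \<omega> *\<^sub>R indicator {0..y} (snd \<omega>))"
    using F.real_cond_exp_intA[OF int SF] by (simp add: set_lebesgue_integral_def)
  also have "\<dots> = (LINT \<omega>|\<mu>. indicator ({0..x} \<times> {0..y}) \<omega>)"
    by (rule Bochner_Integration.integral_cong) (use x y in \<open>auto simp: S_def sp indicator_def\<close>)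
  also have "\<dots> = measure \<mu> ({0..x} \<times> {0..y})"
    using x y by (simp add: sp Times_Int_Times Int_absorb2)
  finally show "(LINT s|lebesgue_unit. indicator {0..x} s * measure (K s) {0..y}) = C x y"
    using mC[OF x y] by simp
qed

text \<open>The uniform distribution followed by the kernel is a measure on the square; the integral
  condition says that it is the measure of the copula.\<close>
lemma is_markov_kernelI:
  assumes K: "K \<in> borel_unit \<rightarrow>\<^sub>M prob_algebra borel_unit"
    and int: "\<And>x y. x \<in> {0..1} \<Longrightarrow> y \<in> {0..1} \<Longrightarrow>
          (LINT s|lebesgue_unit. indicator {0..x} s * measure (K s) {0..y}) = C x y"
  shows "is_markov_kernel C K"
proof -
  define L where "L = (\<lambda>x. distr (K x) (borel_unit \<Otimes>\<^sub>M borel_unit) (Pair x))"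
  define \<mu> where "\<mu> = lebesgue_unit \<bind> L"
  interpret lu: prob_space lebesgue_unit by (rule prob_space_lebesgue_unit)
  have K': "K \<in> lebesgue_unit \<rightarrow>\<^sub>M prob_algebra borel_unit"
    using K by (simp add: measurable_cong_sets[OF sets_lebesgue_unit refl])
  have "L \<in> borel_unit \<rightarrow>\<^sub>M prob_algebra (borel_unit \<Otimes>\<^sub>M borel_unit)"
    unfolding L_def by (rule measurable_distr_prob_space2[OF K]) simp
  then have L: "L \<in> lebesgue_unit \<rightarrow>\<^sub>M prob_algebra (borel_unit \<Otimes>\<^sub>M borel_unit)"
    by (simp add: measurable_cong_sets[OF sets_lebesgue_unit refl])
  have lup: "lebesgue_unit \<in> space (prob_algebra lebesgue_unit)"
    by (simp add: space_prob_algebra prob_space_lebesgue_unit)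
  interpret prob_space \<mu> unfolding \<mu>_def by (rule prob_space_bind'[OF lup L])
  have sm: "sets \<mu> = sets (borel_unit \<Otimes>\<^sub>M borel_unit)" unfolding \<mu>_def
    by (rule sets_bind[OF _ lu.not_empty]) (rule sets_kernel[OF measurable_prob_algebraD[OF L]])
  have sp: "space \<mu> = {0..1} \<times> {0..1}"
    using sets_eq_imp_space_eq[OF sm] by (simp add: space_pair_measure space_restrict_space)
  have rect: "measure \<mu> (A \<times> B) = (LINT s|lebesgue_unit. indicator A s * measure (K s) B)"
    if A: "A \<in> sets borel_unit" and B: "B \<in> sets borel_unit" for A B
  proof -
    have AB: "A \<times> B \<in> sets (borel_unit \<Otimes>\<^sub>M borel_unit)" using A B by (rule pair_measureI)
    have "emeasure \<mu> (A \<times> B) = (\<integral>\<^sup>+s. emeasure (L s) (A \<times> B) \<partial>lebesgue_unit)"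
      unfolding \<mu>_def by (rule emeasure_bind_prob_algebra[OF lup L AB])
    also have "\<dots> = (\<integral>\<^sup>+s. ennreal (indicator A s * measure (K s) B) \<partial>lebesgue_unit)"
    proof (rule nn_integral_cong)
      fix s assume s: "s \<in> space lebesgue_unit"
      then have s01: "s \<in> {0..1}" by (simp add: space_restrict_space)
      interpret Ks: prob_space "K s" by (rule kernel_prob_space[OF K s01])
      have "emeasure (L s) (A \<times> B) = emeasure (K s) (Pair s -` (A \<times> B) \<inter> space (K s))"
        unfolding L_def
      proof (rule emeasure_distr[OF _ AB])
        show "Pair s \<in> K s \<rightarrow>\<^sub>M borel_unit \<Otimes>\<^sub>M borel_unit"
          using s01 by (simp add: measurable_cong_sets[OF kernel_prob_space(2)[OF K s01] refl] space_restrict_space)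
      qed
      also have "Pair s -` (A \<times> B) \<inter> space (K s) = (if s \<in> A then B else {})"
        using sets.sets_into_space[OF B] by (auto simp: kernel_prob_space(3)[OF K s01] space_restrict_space)
      finally show "emeasure (L s) (A \<times> B) = ennreal (indicator A s * measure (K s) B)"
        by (simp add: Ks.emeasure_eq_measure)
    qed
    also have "\<dots> = ennreal (LINT s|lebesgue_unit. indicator A s * measure (K s) B)"
      by (rule nn_integral_eq_integral[OF integrable_kernel_measure[OF K B A]]) auto
    finally show ?thesis by (simp add: measure_def)
  qed
  have cm: "copula_measure C \<mu>" unfolding copula_measure_def
    using sm int by (auto simp: rect Icc_in_borel_unit prob_space_axioms)
  have [measurable]: "fst \<in> \<mu> \<rightarrow>\<^sub>M borel_unit" "snd \<in> \<mu> \<rightarrow>\<^sub>M borel_unit"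
    by (simp_all add: measurable_cong_sets[OF sm refl])
  define F where "F = vimage_algebra (space \<mu>) fst borel_unit"
  interpret F: finite_measure_subalgebra \<mu> F
    unfolding F_def by unfold_locales (rule subalgebra_vimage, measurable)
  have fstF: "fst \<in> F \<rightarrow>\<^sub>M borel_unit" unfolding F_def
    by (rule measurable_vimage_algebra1) (auto simp: sp space_restrict_space)
  have marg: "distr \<mu> borel_unit fst = lebesgue_unit"
  proof (rule measure_eqI_borel_unit)
    show "finite_measure (distr \<mu> borel_unit fst)"
      by (intro finite_measure_distr) measurable
    show "finite_measure lebesgue_unit" by (rule lu.finite_measure_axioms)
    fix x :: real assume x: "x \<in> {0..1}"
    have "measure (distr \<mu> borel_unit fst) {0..x} = measure \<mu> (fst -` {0..x} \<inter> space \<mu>)"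
      using x by (intro measure_distr Icc_in_borel_unit) auto
    also have "fst -` {0..x} \<inter> space \<mu> = {0..x} \<times> {0..1}" using x by (auto simp: sp)
    also have "measure \<mu> \<dots> = (LINT s|lebesgue_unit. indicator {0..x} s * measure (K s) {0..1})"
      using x by (intro rect Icc_in_borel_unit) auto
    also have "\<dots> = (LINT s|lebesgue_unit. indicator {0..x} s)"
    proof (rule Bochner_Integration.integral_cong)
      fix s assume "s \<in> space lebesgue_unit"
      then have s01: "s \<in> {0..1}" by (simp add: space_restrict_space)
      show "indicator {0..x} s * measure (K s) {0..1} = (indicator {0..x} s :: real)"
        using prob_space.prob_space[OF kernel_prob_space(1)[OF K s01]] by (simp add: kernel_prob_space(3)[OF K s01])
    qed simp
    also have "\<dots> = measure lebesgue_unit ({0..x} \<inter> space lebesgue_unit)" by simp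
    also have "{0..x} \<inter> space lebesgue_unit = {0..x}" using x by (auto simp: space_restrict_space)
    finally show "measure (distr \<mu> borel_unit fst) {0..x} = measure lebesgue_unit {0..x}" .
  qed (simp_all add: sets_lebesgue_unit)
  have "regular_cond_distr \<mu> fst snd K" unfolding regular_cond_distr_def
  proof (intro conjI K ballI)
    fix B assume B[measurable]: "B \<in> sets borel_unit"
    note [measurable] = measurable_kernel_measure[OF K B]
    have "AE \<omega> in \<mu>. real_cond_exp \<mu> F (\<lambda>\<omega>. indicator B (snd \<omega>)) \<omega> = measure (K (fst \<omega>)) B"
    proof (rule F.real_cond_exp_charact)
      show "integrable \<mu> (\<lambda>\<omega>. indicator B (snd \<omega>) :: real)"
      proof (rule integrable_const_bound[of _ 1])
        show "(\<lambda>\<omega>. indicator B (snd \<omega>) :: real) \<in> borel_measurable \<mu>" by measurable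
      qed (simp add: indicator_def)
      show "integrable \<mu> (\<lambda>\<omega>. measure (K (fst \<omega>)) B)"
      proof (rule integrable_const_bound[of _ 1])
        show "AE \<omega> in \<mu>. norm (measure (K (fst \<omega>)) B) \<le> 1"
          by (rule AE_I2) (auto simp: sp intro!: prob_space.prob_le_1 kernel_prob_space[OF K])
      qed measurable
      show "(\<lambda>\<omega>. measure (K (fst \<omega>)) B) \<in> borel_measurable F"
        by (rule measurable_compose[OF fstF]) measurable
      fix S assume "S \<in> sets F"
      then obtain A where A[measurable]: "A \<in> sets borel_unit" and S: "S = fst -` A \<inter> space \<mu>"
        unfolding F_def by (subst (asm) sets_vimage_algebra2) (auto simp: sp space_restrict_space)
      have AB: "A \<times> B \<subseteq> space \<mu>" using sets.sets_into_space[OF A] sets.sets_into_space[OF B]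
        by (auto simp: sp space_restrict_space)
      have "(LINT \<omega>:S|\<mu>. indicator B (snd \<omega>)) = (LINT \<omega>|\<mu>. indicator (A \<times> B) \<omega> :: real)"
        unfolding set_lebesgue_integral_def
        by (rule Bochner_Integration.integral_cong) (auto simp: S indicator_def)
      also have "\<dots> = measure \<mu> (A \<times> B)" using AB by (simp add: Int_absorb2)
      also have "\<dots> = (LINT s|distr \<mu> borel_unit fst. indicator A s * measure (K s) B)"
        unfolding marg by (rule rect[OF A B])
      also have "\<dots> = (LINT \<omega>|\<mu>. indicator A (fst \<omega>) * measure (K (fst \<omega>)) B)"
        by (intro integral_distr) measurable
      also have "\<dots> = (LINT \<omega>:S|\<mu>. measure (K (fst \<omega>)) B)"
        unfolding set_lebesgue_integral_def
        by (rule Bochner_Integration.integral_cong) (auto simp: S indicator_def)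
      finally show "(LINT \<omega>:S|\<mu>. indicator B (snd \<omega>)) = (LINT \<omega>:S|\<mu>. measure (K (fst \<omega>)) B)" .
    qed
    then show "AE \<omega> in \<mu>. measure (K (fst \<omega>)) B = real_cond_exp \<mu>
        (vimage_algebra (space \<mu>) fst borel_unit) (\<lambda>\<omega>. indicator B (snd \<omega>)) \<omega>"
      unfolding F_def by (auto elim: AE_mp)
  qed
  with cm show ?thesis by (auto simp: is_markov_kernel_def)
qed

section \<open>Pickands dependence functions and their right derivatives\<close>

lemma pickandsD:
  assumes "pickands A"
  shows "A 0 = 1" "A 1 = 1"
  using assms by (auto simp: pickands_def)

lemma pickands_bounds:
  assumes "pickands A" and "x \<in> {0..1}"
  shows "1 - x \<le> A x" "x \<le> A x" "A x \<le> 1"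
  using assms by (auto simp: pickands_def)

lemma pickands_chord_slopes:
  assumes A: "pickands A" and "0 \<le> x" "x < y" "y < z" "z \<le> 1"
  shows "(A y - A x) / (y - x) \<le> (A z - A x) / (z - x)"
    and "(A z - A x) / (z - x) \<le> (A z - A y) / (z - y)"
proof -
  have "convex_on {0..1} A" using A by (simp add: pickands_def)
  from convex_on_slope_le[OF this, of x z y] assms
  have *: "(A x - A y) / (x - y) \<le> (A x - A z) / (x - z)" "(A x - A z) / (x - z) \<le> (A y - A z) / (y - z)"
    by auto
  have flip: "(a - b) / (c - d) = (b - a) / (d - c)" for a b c d :: real
    by (metis minus_diff_eq minus_divide_divide)
  show "(A y - A x) / (y - x) \<le> (A z - A x) / (z - x)" using *(1) by (simp add: flip)
  show "(A z - A x) / (z - x) \<le> (A z - A y) / (z - y)" using *(2) by (simp add: flip)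
qed

text \<open>Chord slopes increase, so all of them lie between the first chord from \<open>0\<close> and the last chord
  to \<open>1\<close>; the bound \<open>max (1 - x) x \<le> A x\<close> keeps those two within \<open>[-1, 1]\<close>.\<close>
lemma pickands_lipschitz:
  assumes A: "pickands A" and "x \<in> {0..1}" "y \<in> {0..1}"
  shows "\<bar>A x - A y\<bar> \<le> 1 * \<bar>x - y\<bar>"
proof -
  have *: "\<bar>A y - A x\<bar> \<le> y - x" if "0 \<le> x" "x < y" "y \<le> 1" for x y
  proof -
    have "(A y - A x) / (y - x) \<le> 1"
    proof (cases "y = 1")
      case True then show ?thesis using that pickandsD[OF A] pickands_bounds[OF A, of x] by (simp add: divide_le_eq)
    next
      case False
      then have y: "y < 1" using that by simp
      have "(A y - A x) / (y - x) \<le> (A 1 - A x) / (1 - x)"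
        using pickands_chord_slopes[OF A, of x y 1] that y by auto
      also have "\<dots> \<le> 1" using pickandsD[OF A] pickands_bounds[OF A, of x] that by (simp add: divide_le_eq)
      finally show ?thesis .
    qed
    moreover have "-1 \<le> (A y - A x) / (y - x)"
    proof (cases "x = 0")
      case True then show ?thesis using that pickandsD[OF A] pickands_bounds[OF A, of y] by (simp add: le_divide_eq)
    next
      case False
      then have x: "0 < x" using that by simp
      have "-1 \<le> (A y - A 0) / (y - 0)" using pickandsD[OF A] pickands_bounds[OF A, of y] that by (simp add: le_divide_eq)
      also have "\<dots> \<le> (A y - A x) / (y - x)"
        using pickands_chord_slopes[OF A, of 0 x y] that x by auto
      finally show ?thesis .
    qed
    ultimately show ?thesis using that by (auto simp: le_divide_eq divide_le_eq)
  qed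
  show ?thesis using *[of x y] *[of y x] assms by (cases x y rule: linorder_cases) auto
qed

text \<open>The chord slopes from \<open>x\<close> decrease as the right endpoint approaches \<open>x\<close> and are bounded below.\<close>
lemma pickands_has_right_deriv:
  assumes A: "pickands A" and x: "x \<in> {0<..<1}"
  shows "(A has_real_derivative right_deriv A x) (at_right x)"
proof -
  let ?q = "\<lambda>y. (A y - A x) / (y - x)"
  have "(?q \<longlongrightarrow> Inf (?q ` ({x<..} \<inter> {..1}))) (at x within ({x<..} \<inter> {..1}))"
  proof (rule Lim_right_bound)
    fix a b assume "a \<in> {..1::real}" "b \<in> {..1}" "x < a" "a \<le> b"
    then show "?q a \<le> ?q b"
      using pickands_chord_slopes(1)[OF A, of x a b] x by (cases "a = b") auto
  next
    fix a assume "a \<in> {..1::real}" "x < a"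
    then show "-1 \<le> ?q a"
      using pickands_lipschitz[OF A, of a x] x by (auto simp: le_divide_eq)
  qed
  also have "at x within ({x<..} \<inter> {..1}) = at_right x"
    by (rule at_within_nhd[of x "{..<1}"]) (use x in auto)
  finally have d: "(A has_real_derivative Inf (?q ` ({x<..} \<inter> {..1}))) (at_right x)"
    by (simp add: has_field_derivative_iff)
  then have "right_deriv A x = Inf (?q ` ({x<..} \<inter> {..1}))"
    unfolding right_deriv_def
    by (intro vector_derivative_within) (auto simp: has_real_derivative_iff_has_vector_derivative)
  with d show ?thesis by simp
qed

text \<open>The right derivative at a point separates the slopes of chords to its left from those of chords
  to its right; convexity enters the convergence arguments in this form.\<close>
lemma right_deriv_le_slope:
  assumes A: "pickands A" and "0 < x" "x < y" "y \<le> 1"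
  shows "right_deriv A x \<le> (A y - A x) / (y - x)"
proof (rule tendsto_upperbound)
  show "((\<lambda>z. (A z - A x) / (z - x)) \<longlongrightarrow> right_deriv A x) (at_right x)"
    using pickands_has_right_deriv[OF A, of x] assms by (simp add: has_field_derivative_iff)
  show "eventually (\<lambda>z. (A z - A x) / (z - x) \<le> (A y - A x) / (y - x)) (at_right x)"
    using eventually_at_right_real[OF \<open>x < y\<close>]
    by eventually_elim (use pickands_chord_slopes(1)[OF A, of x _ y] assms in auto)
qed simp

lemma slope_le_right_deriv:
  assumes A: "pickands A" and "0 \<le> y" "y < x" "x < 1"
  shows "(A x - A y) / (x - y) \<le> right_deriv A x"
proof (rule tendsto_lowerbound)
  show "((\<lambda>z. (A z - A x) / (z - x)) \<longlongrightarrow> right_deriv A x) (at_right x)"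
    using pickands_has_right_deriv[OF A, of x] assms by (simp add: has_field_derivative_iff)
  show "eventually (\<lambda>z. (A x - A y) / (x - y) \<le> (A z - A x) / (z - x)) (at_right x)"
    using eventually_at_right_real[OF \<open>x < 1\<close>]
  proof eventually_elim
    case (elim z)
    then show ?case using pickands_chord_slopes[OF A, of y x z] assms by auto
  qed
qed simp

lemma pickands_support_line:
  assumes A: "pickands A" and "x \<in> {0<..<1}" "y \<in> {0..1}"
  shows "A x + right_deriv A x * (y - x) \<le> A y"
  using right_deriv_le_slope[OF A, of x y] slope_le_right_deriv[OF A, of y x] assms
  by (cases x y rule: linorder_cases) (auto simp: field_simps)

lemma mono_on_right_deriv:
  assumes A: "pickands A"
  shows "mono_on {0<..<1} (right_deriv A)"
proof (rule mono_onI)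
  fix x y :: real assume "x \<in> {0<..<1}" "y \<in> {0<..<1}" "x \<le> y"
  then show "right_deriv A x \<le> right_deriv A y"
    using right_deriv_le_slope[OF A, of x y] slope_le_right_deriv[OF A, of x y]
    by (cases "x = y") auto
qed

lemma abs_right_deriv_le:
  assumes A: "pickands A" and x: "x \<in> {0<..<1}"
  shows "\<bar>right_deriv A x\<bar> \<le> 1"
proof -
  have "right_deriv A x \<le> (A 1 - A x) / (1 - x)" using right_deriv_le_slope[OF A, of x 1] x by auto
  also have "\<dots> \<le> 1" using pickandsD[OF A] pickands_bounds[OF A, of x] x by (auto simp: divide_le_eq)
  finally have 1: "right_deriv A x \<le> 1" .
  have "-1 \<le> (A x - A 0) / (x - 0)" using pickandsD[OF A] pickands_bounds[OF A, of x] x by (auto simp: le_divide_eq)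
  also have "\<dots> \<le> right_deriv A x" using slope_le_right_deriv[OF A, of 0 x] x by auto
  finally show ?thesis using 1 by simp
qed

lemma pickands_continuous_on:
  assumes A: "pickands A" shows "continuous_on {0..1} A"
proof (rule continuous_onI)
  fix x e :: real assume "x \<in> {0..1}" "e > 0"
  then have "dist (A y) (A x) \<le> e" if "y \<in> {0..1}" "dist y x < e" for y
    using pickands_lipschitz[OF A, of y x] that by (simp add: dist_real_def)
  with \<open>e > 0\<close> show "\<exists>d>0. \<forall>y\<in>{0..1}. dist y x < d \<longrightarrow> dist (A y) (A x) \<le> e" by blast
qed

lemma pickands_isCont: "pickands A \<Longrightarrow> x \<in> {0<..<1} \<Longrightarrow> isCont A x"
  using pickands_continuous_on[of A]
  by (intro continuous_on_interior[of "{0..1}"]) auto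

text \<open>For fixed \<open>z\<close> the chord slope from \<open>y\<close> to \<open>z\<close> is continuous in \<open>y\<close> and bounds the derivative at
  \<open>y\<close> from above; choosing \<open>z\<close> close to \<open>x\<close> bounds the limit by the derivative at \<open>x\<close>.\<close>
lemma right_deriv_right_continuous:
  assumes A: "pickands A" and x: "x \<in> {0<..<1}"
  shows "(right_deriv A \<longlongrightarrow> right_deriv A x) (at_right x)"
proof (rule order_tendstoI)
  fix l assume l: "l < right_deriv A x"
  have "eventually (\<lambda>y. y \<in> {x<..<1}) (at_right x)" by (rule eventually_at_right_real) (use x in auto)
  then show "eventually (\<lambda>y. l < right_deriv A y) (at_right x)"
  proof eventually_elim
    case (elim y)
    then show ?case using mono_onD[OF mono_on_right_deriv[OF A], of x y] l x by auto
  qed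
next
  fix u assume u: "right_deriv A x < u"
  have "((\<lambda>z. (A z - A x) / (z - x)) \<longlongrightarrow> right_deriv A x) (at_right x)"
    using pickands_has_right_deriv[OF A x] by (simp add: has_field_derivative_iff)
  from eventually_happens'[OF trivial_limit_at_right_real
      eventually_conj[OF order_tendstoD(2)[OF this u] eventually_at_right_real[of x 1]]] x
  obtain z where z: "(A z - A x) / (z - x) < u" "x < z" "z < 1" by auto
  have "isCont (\<lambda>y. (A z - A y) / (z - y)) x"
    using pickands_isCont[OF A x] z by (intro continuous_intros) auto
  then have "((\<lambda>y. (A z - A y) / (z - y)) \<longlongrightarrow> (A z - A x) / (z - x)) (at_right x)"
    unfolding isCont_def by (rule tendsto_within_subset) simp
  from order_tendstoD(2)[OF this z(1)] eventually_at_right_real[OF \<open>x < z\<close>]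
  show "eventually (\<lambda>y. right_deriv A y < u) (at_right x)"
  proof eventually_elim
    case (elim y)
    then show ?case using right_deriv_le_slope[OF A, of y z] z x by auto
  qed
qed

text \<open>The derivatives of \<open>An n\<close> at \<open>x\<close> are squeezed between chord slopes to the left and to the right
  of \<open>x\<close>, and chord slopes converge with the functions.\<close>
lemma right_deriv_tendsto_of_pickands_tendsto:
  assumes A: "pickands A" and An: "\<And>n. pickands (An n)"
    and conv: "\<And>x. x \<in> {0..1} \<Longrightarrow> (\<lambda>n. An n x) \<longlonglongrightarrow> A x"
    and x: "x \<in> cont_points_right_deriv A"
  shows "(\<lambda>n. right_deriv (An n) x) \<longlonglongrightarrow> right_deriv A x"
proof (rule order_tendstoI)
  have x01: "x \<in> {0<..<1}" and cont: "isCont (right_deriv A) x"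
    using x by (auto simp: cont_points_right_deriv_def)
  have slope: "(\<lambda>n. (An n z - An n y) / (z - y)) \<longlonglongrightarrow> (A z - A y) / (z - y)"
    if "y \<in> {0..1}" "z \<in> {0..1}" for y z
    using that unfolding divide_inverse by (intro tendsto_intros conv)
  {
    fix u assume u: "right_deriv A x < u"
    have "((\<lambda>z. (A z - A x) / (z - x)) \<longlongrightarrow> right_deriv A x) (at_right x)"
      using pickands_has_right_deriv[OF A x01] by (simp add: has_field_derivative_iff)
    from eventually_happens'[OF trivial_limit_at_right_real
        eventually_conj[OF order_tendstoD(2)[OF this u] eventually_at_right_real[of x 1]]] x01
    obtain z where z: "(A z - A x) / (z - x) < u" "x < z" "z < 1" by auto
    have "eventually (\<lambda>n. (An n z - An n x) / (z - x) < u) sequentially"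
      by (rule order_tendstoD(2)[OF slope z(1)]) (use x01 z in auto)
    then show "eventually (\<lambda>n. right_deriv (An n) x < u) sequentially"
    proof eventually_elim
      case (elim n)
      then show ?case using right_deriv_le_slope[OF An, of x z n] x01 z by auto
    qed
  next
    fix l assume l: "l < right_deriv A x"
    have "(right_deriv A \<longlongrightarrow> right_deriv A x) (at_left x)"
      using cont unfolding isCont_def by (rule tendsto_within_subset) simp
    from eventually_happens'[OF trivial_limit_at_left_real
        eventually_conj[OF order_tendstoD(1)[OF this l] eventually_at_left_real[of 0 x]]] x01
    \<comment> \<open>Continuity at \<open>x\<close> enters here only: it supplies a point to the left of \<open>x\<close> where the derivative still exceeds \<open>l\<close>.\<close>
    obtain z where z: "l < right_deriv A z" "0 < z" "z < x" by auto
    then have "l < (A x - A z) / (x - z)"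
      using right_deriv_le_slope[OF A, of z x] x01 by auto
    then have "eventually (\<lambda>n. l < (An n x - An n z) / (x - z)) sequentially"
      by (rule order_tendstoD(1)[OF slope, rotated 2]) (use x01 z in auto)
    then show "eventually (\<lambda>n. l < right_deriv (An n) x) sequentially"
    proof eventually_elim
      case (elim n)
      then show ?case using slope_le_right_deriv[OF An, of z x n] x01 z by auto
    qed
  }
qed

lemma right_deriv_quotients:
  assumes A: "pickands A" and x: "x \<in> {0<..<1}"
  shows "(\<lambda>n. (A (x + 1 / real (Suc n)) - A x) / (1 / real (Suc n))) \<longlonglongrightarrow> right_deriv A x"
proof -
  have "filterlim (\<lambda>n. x + 1 / real (Suc n)) (at_right x) sequentially"
  proof (rule tendsto_imp_filterlim_at_right)
    have "(\<lambda>n. x + 1 / real (Suc n)) \<longlonglongrightarrow> x + 0"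
      by (intro tendsto_intros LIMSEQ_Suc lim_1_over_n)
    then show "(\<lambda>n. x + 1 / real (Suc n)) \<longlonglongrightarrow> x" by simp
  qed auto
  moreover have "((\<lambda>z. (A z - A x) / (z - x)) \<longlongrightarrow> right_deriv A x) (at_right x)"
    using pickands_has_right_deriv[OF A x] by (simp add: has_field_derivative_iff)
  ultimately show ?thesis using filterlim_compose by fastforce
qed

text \<open>The dependence function is recovered from its derivative because its value at \<open>0\<close> is known.\<close>
lemma pickands_eq_integral_right_deriv:
  assumes A: "pickands A" and x: "x \<in> {0..1}"
  shows "integrable lborel (\<lambda>z. indicator {0<..<x} z * right_deriv A z)"
    and "A x = 1 + (LINT z|lborel. indicator {0<..<x} z * right_deriv A z)"
proof -
  note * = lipschitz_integral_of_difference_quotient_limit[of 0 x A 1 "\<lambda>n. 1 / real (Suc n)" "right_deriv A",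
      OF _ pickands_lipschitz[OF A] LIMSEQ_Suc[OF lim_1_over_n] _ right_deriv_quotients[OF A]]
  show "integrable lborel (\<lambda>z. indicator {0<..<x} z * right_deriv A z)"
    by (rule *(1)) (use x in auto)
  have "(LINT z|lborel. indicator {0<..<x} z * right_deriv A z) = A x - A 0"
    by (rule *(2)) (use x in auto)
  then show "A x = 1 + (LINT z|lborel. indicator {0<..<x} z * right_deriv A z)"
    using pickandsD(1)[OF A] by simp
qed

lemma countable_discontinuities_right_deriv:
  assumes A: "pickands A"
  shows "countable ({0<..<1} - cont_points_right_deriv A)"
proof -
  have "countable {a\<in>{0<..<1}. \<not> isCont (right_deriv A) a}"
    by (rule mono_on_ctble_discont_open[OF open_greaterThanLessThan mono_on_right_deriv[OF A]])
  moreover have "{a\<in>{0<..<1}. \<not> isCont (right_deriv A) a} = {0<..<1} - cont_points_right_deriv A"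
    by (auto simp: cont_points_right_deriv_def)
  ultimately show ?thesis by simp
qed

lemma AE_lborel_not_in_countable: "countable N \<Longrightarrow> AE x in lborel. x \<notin> (N :: real set)"
  by (intro AE_not_in countable_imp_null_set_lborel)

text \<open>Dominated convergence in the integral representation: the derivatives are bounded by \<open>1\<close> and
  converge off a countable set.\<close>
lemma pickands_tendsto_of_right_deriv_tendsto:
  assumes A: "pickands A" and An: "\<And>n. pickands (An n)"
    and conv: "\<And>x. x \<in> cont_points_right_deriv A \<Longrightarrow> (\<lambda>n. right_deriv (An n) x) \<longlonglongrightarrow> right_deriv A x"
    and x: "x \<in> {0..1}"
  shows "(\<lambda>n. An n x) \<longlonglongrightarrow> A x"
proof -
  have "(\<lambda>n. LINT z|lborel. indicator {0<..<x} z * right_deriv (An n) z)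
      \<longlonglongrightarrow> (LINT z|lborel. indicator {0<..<x} z * right_deriv A z)"
  proof (rule integral_dominated_convergence)
    show "integrable lborel (indicator {0<..<x} :: real \<Rightarrow> real)" using x by simp
    show "AE z in lborel. (\<lambda>n. indicator {0<..<x} z * right_deriv (An n) z)
        \<longlonglongrightarrow> indicator {0<..<x} z * right_deriv A z"
      using AE_lborel_not_in_countable[OF countable_discontinuities_right_deriv[OF A]]
    proof eventually_elim
      case (elim z)
      show ?case
      proof (cases "z \<in> {0<..<x}")
        case True
        then have "z \<in> cont_points_right_deriv A" using elim x by auto
        then show ?thesis by (intro tendsto_intros conv)
      qed auto
    qed
    show "AE z in lborel. norm (indicator {0<..<x} z * right_deriv (An n) z) \<le> indicator {0<..<x} z" for n
      using abs_right_deriv_le[OF An[of n]] x by (intro AE_I2) (auto simp: indicator_def)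
  qed (use pickands_eq_integral_right_deriv(1)[OF A x] pickands_eq_integral_right_deriv(1)[OF An x] in auto)
  then have "(\<lambda>n. 1 + (LINT z|lborel. indicator {0<..<x} z * right_deriv (An n) z))
      \<longlonglongrightarrow> 1 + (LINT z|lborel. indicator {0<..<x} z * right_deriv A z)"
    by (intro tendsto_intros)
  then show ?thesis
    using pickands_eq_integral_right_deriv(2)[OF A x] pickands_eq_integral_right_deriv(2)[OF An x] by simp
qed

section \<open>Copulas and the logarithmic coordinate\<close>

lemma copula_mono_right:
  assumes C: "is_copula C" and "x \<in> {0..1}" "y1 \<in> {0..1}" "y2 \<in> {0..1}" "y1 \<le> y2"
  shows "C x y1 \<le> C x y2"
proof -
  have "C x y2 - C 0 y2 - C x y1 + C 0 y1 \<ge> 0"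
    using C[unfolded is_copula_def, THEN conjunct2, rule_format, of 0 x y1 y2] assms by auto
  then show ?thesis using C assms by (auto simp: is_copula_def)
qed

text \<open>Rectangles reaching to the sides \<open>0\<close> and \<open>1\<close> of the square bound the increments, since the
  margins are known there.\<close>
lemma copula_lipschitz:
  assumes C: "is_copula C" and x: "x1 \<in> {0..1}" "x2 \<in> {0..1}" and y: "y1 \<in> {0..1}" "y2 \<in> {0..1}"
  shows "\<bar>C x1 y1 - C x2 y2\<bar> \<le> \<bar>x1 - x2\<bar> + \<bar>y1 - y2\<bar>"
proof -
  have two: "C x2 y2 - C x1 y2 - C x2 y1 + C x1 y1 \<ge> 0"
    if "x1 \<in> {0..1}" "x2 \<in> {0..1}" "y1 \<in> {0..1}" "y2 \<in> {0..1}" "x1 \<le> x2" "y1 \<le> y2" for x1 x2 y1 y2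
    using C[unfolded is_copula_def, THEN conjunct2, rule_format, of x1 x2 y1 y2] that by auto
  have margins: "C t 0 = 0" "C 0 t = 0" "C t 1 = t" "C 1 t = t" if "t \<in> {0..1}" for t
    using C that by (auto simp: is_copula_def)
  have h: "0 \<le> C x2 y - C x1 y \<and> C x2 y - C x1 y \<le> x2 - x1"
    if "x1 \<in> {0..1}" "x2 \<in> {0..1}" "y \<in> {0..1}" "x1 \<le> x2" for x1 x2 y
    using two[of x1 x2 0 y] two[of x1 x2 y 1] that by (auto simp: margins)
  have v: "0 \<le> C x y2 - C x y1 \<and> C x y2 - C x y1 \<le> y2 - y1"
    if "y1 \<in> {0..1}" "y2 \<in> {0..1}" "x \<in> {0..1}" "y1 \<le> y2" for y1 y2 x
    using two[of 0 x y1 y2] two[of x 1 y1 y2] that by (auto simp: margins)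
  have "\<bar>C x1 y1 - C x2 y1\<bar> \<le> \<bar>x1 - x2\<bar>" using h[of x1 x2 y1] h[of x2 x1 y1] x y by linarith
  moreover have "\<bar>C x2 y1 - C x2 y2\<bar> \<le> \<bar>y1 - y2\<bar>" using v[of y1 y2 x2] v[of y2 y1 x2] x y by linarith
  ultimately show ?thesis by linarith
qed

lemma copula_bounds:
  assumes C: "is_copula C" and "x \<in> {0..1}" "y \<in> {0..1}"
  shows "0 \<le> C x y" "C x y \<le> x" "C x y \<le> y"
proof -
  have m: "C x 0 = 0" "C x 1 = x" "C 0 y = 0" using C assms by (auto simp: is_copula_def)
  show "0 \<le> C x y" "C x y \<le> x"
    using copula_mono_right[OF C, of x 0 y] copula_mono_right[OF C, of x y 1] assms m by auto
  show "C x y \<le> y" using copula_lipschitz[OF C, of x x y 0] assms m by auto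
qed

text \<open>The argument of the dependence function. For \<open>u = - ln x\<close> and \<open>v = - ln y\<close> it is \<open>u / (u + v)\<close>, hence
  strictly increasing in \<open>y\<close> and strictly decreasing in \<open>x\<close>.\<close>
definition log_ratio :: "real \<Rightarrow> real \<Rightarrow> real" where
  "log_ratio x y = ln x / ln (x * y)"

lemma log_ratio_eq: "0 < x \<Longrightarrow> 0 < y \<Longrightarrow> log_ratio x y = ln x / (ln x + ln y)"
  by (simp add: log_ratio_def ln_mult)

lemma log_ratio_in_unit: "x \<in> {0<..<1} \<Longrightarrow> y \<in> {0<..<1} \<Longrightarrow> log_ratio x y \<in> {0<..<1}"
  by (auto simp: log_ratio_eq divide_simps intro: add_neg_neg)

lemma log_ratio_strict_mono_right:
  assumes "x \<in> {0<..<1}" "0 < y" "y < z" "z < 1"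
  shows "log_ratio x y < log_ratio x z"
proof -
  have "ln x < 0" "ln y < ln z" "ln z < 0" using assms by auto
  then have "ln x * ln y > ln x * ln z" "ln x + ln y < 0" "ln x + ln z < 0"
    by (auto simp: mult_less_cancel_left_neg)
  then show ?thesis using assms by (simp add: log_ratio_eq divide_simps algebra_simps)
qed

lemma log_ratio_strict_antimono_left:
  assumes "y \<in> {0<..<1}" "0 < w" "w < x" "x < 1"
  shows "log_ratio x y < log_ratio w y"
proof -
  have "ln y < 0" "ln w < ln x" "ln x < 0" using assms by auto
  then have "ln y * ln w > ln y * ln x" "ln w + ln y < 0" "ln x + ln y < 0"
    by (auto simp: mult_less_cancel_left_neg)
  then show ?thesis using assms by (simp add: log_ratio_eq divide_simps algebra_simps)
qed

lemma isCont_log_ratio_right: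
  assumes "x \<in> {0<..<1}" "y \<in> {0<..<1}"
  shows "isCont (log_ratio x) y"
  unfolding log_ratio_def using assms mult_strict_mono[of x 1 y 1] by (intro continuous_intros) auto

section \<open>The conditional distribution functions\<close>

text \<open>In the coordinates \<open>u = - ln x\<close>, \<open>v = - ln y\<close> the copula is \<open>exp (- l u v)\<close> with
  \<open>l u v = (u + v) * A (u / (u + v))\<close>. This is the right-hand partial derivative of \<open>l\<close> in \<open>u\<close>, as a
  function of \<open>t = u / (u + v)\<close>. Geometrically, it is the height at \<open>1\<close> of the supporting line of \<open>A\<close>
  at \<open>t\<close>.\<close>
definition kernel_slope :: "(real \<Rightarrow> real) \<Rightarrow> real \<Rightarrow> real" where
  "kernel_slope A t = A t + (1 - t) * right_deriv A t"

text \<open>Inside the square this is the left-hand derivative of the copula in \<open>x\<close>. The other values make it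
  a distribution function in \<open>y\<close> for every \<open>x\<close>; for \<open>x\<close> outside \<open>(0,1)\<close> it is that of the point
  mass at \<open>1\<close>.\<close>
definition ev_cond_cdf :: "(real \<Rightarrow> real) \<Rightarrow> real \<Rightarrow> real \<Rightarrow> real" where
  "ev_cond_cdf A x y =
     (if 1 \<le> y then 1
      else if 0 < x \<and> x < 1 \<and> 0 < y
        then (x * y) powr A (log_ratio x y) / x * kernel_slope A (log_ratio x y)
      else 0)"

text \<open>Supporting lines of a convex function at points further to the right are higher at \<open>1\<close>.\<close>
lemma kernel_slope_mono:
  assumes A: "pickands A" and s: "0 < s" and "s \<le> t" and t: "t < 1"
  shows "kernel_slope A s \<le> kernel_slope A t"
proof -
  have "right_deriv A s * (t - s) \<le> A t - A s"
    using pickands_support_line[OF A, of s t] assms by auto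
  moreover have "(1 - t) * right_deriv A s \<le> (1 - t) * right_deriv A t"
    using mono_onD[OF mono_on_right_deriv[OF A], of s t] assms by (intro mult_left_mono) auto
  ultimately show ?thesis by (simp add: kernel_slope_def algebra_simps)
qed

lemma kernel_slope_bounds:
  assumes A: "pickands A" and t: "t \<in> {0<..<1}"
  shows "0 \<le> kernel_slope A t" "kernel_slope A t \<le> 1"
proof -
  have "(1 - t) * (-1) \<le> (1 - t) * right_deriv A t"
    using abs_right_deriv_le[OF A t] t by (intro mult_left_mono) auto
  then show "0 \<le> kernel_slope A t"
    using pickands_bounds(1)[OF A, of t] t by (auto simp: kernel_slope_def)
  show "kernel_slope A t \<le> 1"
    using pickands_support_line[OF A t, of 1] pickandsD(2)[OF A] by (simp add: kernel_slope_def mult.commute)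
qed

lemma ev_cond_cdf_eq:
  assumes "extreme_value_copula C A" "x \<in> {0<..<1}" "y \<in> {0<..<1}"
  shows "ev_cond_cdf A x y = C x y / x * kernel_slope A (log_ratio x y)"
  using assms by (simp add: extreme_value_copula_def ev_cond_cdf_def log_ratio_def)

lemma ev_cond_cdf_bounds:
  assumes ev: "extreme_value_copula C A"
  shows "0 \<le> ev_cond_cdf A x y" "ev_cond_cdf A x y \<le> 1"
proof -
  have A: "pickands A" and C: "is_copula C" using ev by (auto simp: extreme_value_copula_def)
  have "0 \<le> ev_cond_cdf A x y \<and> ev_cond_cdf A x y \<le> 1"
  proof (cases "x \<in> {0<..<1} \<and> y \<in> {0<..<1}")
    case True
    have "C x y / x \<le> 1" "0 \<le> C x y / x"
      using copula_bounds[OF C, of x y] True by (auto simp: divide_le_eq)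
    moreover have "0 \<le> kernel_slope A (log_ratio x y)" "kernel_slope A (log_ratio x y) \<le> 1"
      by (intro kernel_slope_bounds[OF A] log_ratio_in_unit; use True in blast)+
    ultimately have "0 \<le> C x y / x * kernel_slope A (log_ratio x y)"
      "C x y / x * kernel_slope A (log_ratio x y) \<le> 1"
      using mult_nonneg_nonneg mult_le_one by blast+
    then show ?thesis using True by (simp add: ev_cond_cdf_eq[OF ev])
  qed (auto simp: ev_cond_cdf_def)
  then show "0 \<le> ev_cond_cdf A x y" "ev_cond_cdf A x y \<le> 1" by auto
qed

text \<open>Both factors, \<open>C x y / x\<close> and the slope factor, are nonnegative and increase with \<open>y\<close>.\<close>
lemma ev_cond_cdf_mono:
  assumes ev: "extreme_value_copula C A" and "y \<le> z"
  shows "ev_cond_cdf A x y \<le> ev_cond_cdf A x z"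
proof -
  have A: "pickands A" and C: "is_copula C" using ev by (auto simp: extreme_value_copula_def)
  consider "x \<in> {0<..<1}" "0 < y" "z < 1" | "1 \<le> z" | "z < 1" "y \<le> 0 \<or> x \<notin> {0<..<1}" by force
  then show ?thesis
  proof cases
    case 1
    have "C x y / x * kernel_slope A (log_ratio x y) \<le> C x z / x * kernel_slope A (log_ratio x z)"
    proof (rule mult_mono)
      show "C x y / x \<le> C x z / x"
        using 1 assms(2) by (intro divide_right_mono copula_mono_right[OF C]) auto
      show "kernel_slope A (log_ratio x y) \<le> kernel_slope A (log_ratio x z)"
        using 1 assms(2) log_ratio_in_unit[of x y] log_ratio_in_unit[of x z] log_ratio_strict_mono_right[of x y z]
        by (cases "y = z") (auto intro!: kernel_slope_mono[OF A])
      show "0 \<le> C x z / x" using 1 assms(2) copula_bounds(1)[OF C, of x z] by auto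
      show "0 \<le> kernel_slope A (log_ratio x y)"
        using 1 assms(2) by (intro kernel_slope_bounds[OF A] log_ratio_in_unit) auto
    qed
    then show ?thesis using 1 assms(2) by (simp add: ev_cond_cdf_eq[OF ev])
  next
    case 2
    then have "ev_cond_cdf A x z = 1" by (simp add: ev_cond_cdf_def)
    then show ?thesis using ev_cond_cdf_bounds(2)[OF ev] by simp
  next
    case 3
    then have "ev_cond_cdf A x y = 0" using assms(2) by (auto simp: ev_cond_cdf_def)
    then show ?thesis using ev_cond_cdf_bounds(1)[OF ev] by simp
  qed
qed

text \<open>In the interior, \<open>log_ratio x\<close> is continuous and increasing, so right continuity is inherited from
  the right derivative of the dependence function. At \<open>0\<close> there is no jump because
  \<open>C x y / x \<le> y / x\<close>.\<close>
lemma ev_cond_cdf_right_continuous: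
  assumes ev: "extreme_value_copula C A"
  shows "continuous (at_right y) (ev_cond_cdf A x)"
proof -
  have A: "pickands A" and C: "is_copula C" using ev by (auto simp: extreme_value_copula_def)
  have "y < 0 \<or> 1 \<le> y \<or> (0 \<le> y \<and> y < 1 \<and> x \<notin> {0<..<1}) \<or> (y = 0 \<and> x \<in> {0<..<1}) \<or> (y \<in> {0<..<1} \<and> x \<in> {0<..<1})"
    by auto
  then consider (low) "y < 0" | (high) "1 \<le> y" | (outside) "0 \<le> y" "y < 1" "x \<notin> {0<..<1}"
    | (zero) "y = 0" "x \<in> {0<..<1}" | (inside) "y \<in> {0<..<1}" "x \<in> {0<..<1}" by blast
  then have "(ev_cond_cdf A x \<longlongrightarrow> ev_cond_cdf A x y) (at_right y)"
  proof cases
    case low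
    have "eventually (\<lambda>z. ev_cond_cdf A x y = ev_cond_cdf A x z) (at_right y)"
      using eventually_at_right_real[OF low] by eventually_elim (use low in \<open>auto simp: ev_cond_cdf_def\<close>)
    then show ?thesis by (rule Lim_transform_eventually[OF tendsto_const])
  next
    case high
    have "eventually (\<lambda>z. ev_cond_cdf A x y = ev_cond_cdf A x z) (at_right y)"
      using eventually_at_right_less[of y] by eventually_elim (use high in \<open>auto simp: ev_cond_cdf_def\<close>)
    then show ?thesis by (rule Lim_transform_eventually[OF tendsto_const])
  next
    case outside
    have "eventually (\<lambda>z. ev_cond_cdf A x y = ev_cond_cdf A x z) (at_right y)"
      using eventually_at_right_real[OF outside(2)]
      by eventually_elim (use outside in \<open>auto simp: ev_cond_cdf_def\<close>)
    then show ?thesis by (rule Lim_transform_eventually[OF tendsto_const])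
  next
    case zero
    have x0: "x \<noteq> 0" using zero by auto
    have "((\<lambda>z. z / x) \<longlongrightarrow> 0 / x) (at_right 0)"
      by (rule tendsto_divide[OF tendsto_ident_at tendsto_const x0])
    then have up: "((\<lambda>z. z / x) \<longlongrightarrow> 0) (at_right 0)" by simp
    have le: "eventually (\<lambda>z. ev_cond_cdf A x z \<le> z / x) (at_right 0)"
      using eventually_at_right_real[OF zero_less_one]
    proof eventually_elim
      case (elim z)
      have "C x z / x * kernel_slope A (log_ratio x z) \<le> z / x * 1"
      proof (intro mult_mono divide_right_mono)
        show "C x z \<le> z" by (rule copula_bounds(3)[OF C]) (use elim zero in auto)
        show "kernel_slope A (log_ratio x z) \<le> 1" "0 \<le> kernel_slope A (log_ratio x z)"
          by (intro kernel_slope_bounds[OF A] log_ratio_in_unit; use elim zero in auto)+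
      qed (use elim zero in auto)
      then show ?case using elim zero by (simp add: ev_cond_cdf_eq[OF ev])
    qed
    have "(ev_cond_cdf A x \<longlongrightarrow> 0) (at_right 0)"
    proof (rule tendsto_sandwich[OF _ le tendsto_const up])
      show "eventually (\<lambda>z. 0 \<le> ev_cond_cdf A x z) (at_right 0)"
        by (rule always_eventually) (rule allI, rule ev_cond_cdf_bounds(1)[OF ev])
    qed
    then show ?thesis using zero by (simp add: ev_cond_cdf_def)
  next
    case inside
    let ?t = "log_ratio x y"
    have t: "?t \<in> {0<..<1}" using inside by (intro log_ratio_in_unit)
    have tlim: "(log_ratio x \<longlongrightarrow> ?t) (at_right y)"
      using isCont_log_ratio_right[OF inside(2,1)] unfolding isCont_def by (rule tendsto_within_subset) simp
    have ev_in: "eventually (\<lambda>z. z \<in> {y<..<1}) (at_right y)"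
      by (rule eventually_at_right_real) (use inside in auto)
    have tright: "filterlim (log_ratio x) (at_right ?t) (at_right y)"
    proof (rule tendsto_imp_filterlim_at_right[OF tlim])
      show "eventually (\<lambda>z. ?t < log_ratio x z) (at_right y)"
        using ev_in by eventually_elim (use inside in \<open>auto intro!: log_ratio_strict_mono_right\<close>)
    qed
    have Alim: "((\<lambda>z. A (log_ratio x z)) \<longlongrightarrow> A ?t) (at_right y)"
      by (rule isCont_tendsto_compose[OF pickands_isCont[OF A t] tlim])
    have Dlim: "((\<lambda>z. right_deriv A (log_ratio x z)) \<longlongrightarrow> right_deriv A ?t) (at_right y)"
      by (rule filterlim_compose[OF right_deriv_right_continuous[OF A t] tright])
    have lim: "((\<lambda>z. (x * z) powr A (log_ratio x z) / x * kernel_slope A (log_ratio x z)) \<longlongrightarrow>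
        (x * y) powr A ?t / x * kernel_slope A ?t) (at_right y)"
      unfolding kernel_slope_def
    proof (rule tendsto_mult)
      have xz: "((\<lambda>z. x * z) \<longlongrightarrow> x * y) (at_right y)" by (rule tendsto_mult[OF tendsto_const tendsto_ident_at])
      show "((\<lambda>z. (x * z) powr A (log_ratio x z) / x) \<longlongrightarrow> (x * y) powr A ?t / x) (at_right y)"
        using inside by (intro tendsto_divide[OF tendsto_powr[OF xz Alim] tendsto_const]) auto
      show "((\<lambda>z. A (log_ratio x z) + (1 - log_ratio x z) * right_deriv A (log_ratio x z)) \<longlongrightarrow>
          A ?t + (1 - ?t) * right_deriv A ?t) (at_right y)"
        by (rule tendsto_add[OF Alim tendsto_mult[OF tendsto_diff[OF tendsto_const tlim] Dlim]])
    qed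
    have "eventually (\<lambda>z. (x * z) powr A (log_ratio x z) / x * kernel_slope A (log_ratio x z) = ev_cond_cdf A x z) (at_right y)"
      using ev_in by eventually_elim (use inside in \<open>auto simp: ev_cond_cdf_def\<close>)
    with lim have "(ev_cond_cdf A x \<longlongrightarrow> (x * y) powr A ?t / x * kernel_slope A ?t) (at_right y)"
      by (rule Lim_transform_eventually)
    then show ?thesis using inside by (simp add: ev_cond_cdf_def)
  qed
  then show ?thesis by (simp add: continuous_within)
qed

lemma ev_cond_cdf_lim_at_bot: "(ev_cond_cdf A x \<longlongrightarrow> 0) at_bot"
proof -
  have "eventually (\<lambda>y. 0 = ev_cond_cdf A x y) at_bot"
    using eventually_le_at_bot[of 0] by eventually_elim (auto simp: ev_cond_cdf_def)
  then show ?thesis by (rule Lim_transform_eventually[OF tendsto_const])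
qed

lemma ev_cond_cdf_lim_at_top: "(ev_cond_cdf A x \<longlongrightarrow> 1) at_top"
proof -
  have "eventually (\<lambda>y. 1 = ev_cond_cdf A x y) at_top"
    using eventually_ge_at_top[of 1] by eventually_elim (auto simp: ev_cond_cdf_def)
  then show ?thesis by (rule Lim_transform_eventually[OF tendsto_const])
qed

section \<open>The copula as the integral of its conditional distribution functions\<close>

lemma ev_copula_left_derivative:
  assumes ev: "extreme_value_copula C A" and x: "x \<in> {0<..<1}" and y: "y \<in> {0<..<1}"
  shows "((\<lambda>s. C s y) has_real_derivative ev_cond_cdf A x y) (at x within {0<..<x})"
proof -
  have A: "pickands A" using ev by (auto simp: extreme_value_copula_def)
  let ?t = "log_ratio x y"
  have t: "?t \<in> {0<..<1}" using x y by (rule log_ratio_in_unit)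
  have ln0: "ln x + ln y < 0" using x y by (auto intro: add_neg_neg)
  define g where "g s = ln s / (ln s + ln y)" for s
  \<comment> \<open>\<open>g\<close> is \<open>log_ratio\<close> with the logarithm of the product split, which is easier to differentiate.\<close>
  have gt: "g s = log_ratio s y" if "s \<in> {0<..<1}" for s
    using that y by (simp add: g_def log_ratio_eq)
  have dg: "(g has_real_derivative ln y / (x * (ln x + ln y)\<^sup>2)) (at x within {0<..<x})"
    unfolding g_def using x ln0
    by (auto intro!: derivative_eq_intros simp: field_simps power2_eq_square)
  \<comment> \<open>As \<open>s\<close> increases to \<open>x\<close>, the argument of \<open>A\<close> decreases: a left derivative of the copula needs the right derivative of \<open>A\<close>.\<close>
  have "g ` {0<..<x} \<subseteq> {g x<..}"
    using x y log_ratio_strict_antimono_left[OF y, of _ x] by (auto simp: gt)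
  then have "(A has_real_derivative right_deriv A ?t) (at (g x) within g ` {0<..<x})"
    using pickands_has_right_deriv[OF A t] x by (auto simp: gt intro: DERIV_subset)
  from DERIV_image_chain[OF this dg]
  have dA: "((\<lambda>s. A (g s)) has_real_derivative right_deriv A ?t * (ln y / (x * (ln x + ln y)\<^sup>2))) (at x within {0<..<x})"
    by (simp add: o_def)
  have "((\<lambda>s. exp ((ln s + ln y) * A (g s))) has_real_derivative
      exp ((ln x + ln y) * A (g x)) * (1 / x * A (g x) + right_deriv A ?t * (ln y / (x * (ln x + ln y)\<^sup>2)) * (ln x + ln y)))
      (at x within {0<..<x})"
    using x by (auto intro!: derivative_eq_intros dA)
  moreover have "exp ((ln x + ln y) * A (g x)) * (1 / x * A (g x) + right_deriv A ?t * (ln y / (x * (ln x + ln y)\<^sup>2)) * (ln x + ln y))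
      = ev_cond_cdf A x y"
  proof -
    define L where "L = ln x + ln y"
    have L: "L \<noteq> 0" using ln0 by (simp add: L_def)
    have "1 - ?t = ln y / L" using x y L by (simp add: log_ratio_eq L_def field_simps)
    then have "right_deriv A ?t * (ln y / (x * L\<^sup>2)) * L = (1 - ?t) * right_deriv A ?t / x"
      using L x by (simp add: power2_eq_square mult.commute)
    moreover have "exp (L * A ?t) = (x * y) powr A ?t"
      using x y by (simp add: powr_def ln_mult mult.commute L_def)
    ultimately show ?thesis using x y
      by (simp add: gt ev_cond_cdf_def kernel_slope_def add_divide_distrib distrib_left flip: L_def)
  qed
  ultimately have d: "((\<lambda>s. exp ((ln s + ln y) * A (g s))) has_real_derivative ev_cond_cdf A x y) (at x within {0<..<x})"
    by metis
  have eq: "exp ((ln s + ln y) * A (g s)) = C s y" if "s \<in> {0<..x}" for s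
  proof -
    have "s \<in> {0<..<1}" using that x by auto
    then show ?thesis using ev y
      by (auto simp: gt extreme_value_copula_def powr_def ln_mult log_ratio_def mult.commute)
  qed
  have "eventually (\<lambda>s. exp ((ln s + ln y) * A (g s)) = C s y) (at x within {0<..<x})"
    unfolding eventually_at_filter by (rule always_eventually) (auto intro!: eq)
  then have "((\<lambda>s. exp ((ln s + ln y) * A (g s))) has_real_derivative ev_cond_cdf A x y) (at x within {0<..<x})
      = ((\<lambda>s. C s y) has_real_derivative ev_cond_cdf A x y) (at x within {0<..<x})"
    by (rule has_field_derivative_cong_eventually) (use x eq in auto)
  with d show ?thesis by simp
qed

text \<open>Copulas are Lipschitz, so integrating the left-hand derivative in \<open>x\<close> recovers the copula even when
  the dependence function has kinks.\<close>
lemma ev_copula_integral: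
  assumes ev: "extreme_value_copula C A" and x: "x \<in> {0..1}" and y: "y \<in> {0<..<1}"
  shows "(LINT s|lborel. indicator {0<..<x} s * ev_cond_cdf A s y) = C x y"
proof -
  have C: "is_copula C" using ev by (auto simp: extreme_value_copula_def)
  have "(LINT s|lborel. indicator {0<..<x} s * ev_cond_cdf A s y) = C x y - C 0 y"
  proof (rule lipschitz_integral_of_difference_quotient_limit(2)[where h = "\<lambda>n. - (1 / real (Suc n))" and f = "\<lambda>s. C s y" and L = 1])
    \<comment> \<open>The increments are negative, since the left derivative is the known one.\<close>
    show "(\<lambda>n. - (1 / real (Suc n))) \<longlonglongrightarrow> 0"
      using tendsto_minus[OF LIMSEQ_Suc[OF lim_1_over_n]] by simp
    fix a b assume "a \<in> {0..x}" "b \<in> {0..x}"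
    then show "\<bar>C a y - C b y\<bar> \<le> 1 * \<bar>a - b\<bar>"
      using copula_lipschitz[OF C, of a b y y] x y by auto
  next
    fix s assume s: "s \<in> {0<..<x}"
    have s1: "s \<in> {0<..<1}" using s x by auto
    have lim: "(\<lambda>n. s + - (1 / real (Suc n))) \<longlonglongrightarrow> s + - 0"
      by (intro tendsto_intros LIMSEQ_Suc[OF lim_1_over_n])
    then have "eventually (\<lambda>n. s + - (1 / real (Suc n)) > 0) sequentially"
      using s by (intro order_tendstoD(1)) auto
    then have "filterlim (\<lambda>n. s + - (1 / real (Suc n))) (at s within {0<..<s}) sequentially"
      using lim by (auto simp: filterlim_at elim!: eventually_mono)
    moreover have "((\<lambda>z. (C z y - C s y) / (z - s)) \<longlongrightarrow> ev_cond_cdf A s y) (at s within {0<..<s})"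
      using ev_copula_left_derivative[OF ev s1 y] by (simp add: has_field_derivative_iff)
    ultimately show "(\<lambda>n. (C (s + - (1 / real (Suc n))) y - C s y) / - (1 / real (Suc n))) \<longlonglongrightarrow> ev_cond_cdf A s y"
      using filterlim_compose by fastforce
  qed (use x in auto)
  then show ?thesis using C y by (simp add: is_copula_def)
qed

text \<open>Joint measurability; it is needed to integrate in \<open>x\<close> first and in \<open>y\<close> afterwards.\<close>
lemma measurable_ev_cond_cdf:
  assumes A: "pickands A" and f[measurable]: "f \<in> borel_measurable M" and g[measurable]: "g \<in> borel_measurable M"
  shows "(\<lambda>w. ev_cond_cdf A (f w) (g w)) \<in> borel_measurable M"
proof -
  \<comment> \<open>Cutting off outside \<open>(0,1)\<close> gives globally measurable functions without changing any value that enters the formula.\<close>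
  define A' where "A' t = indicator {0<..<1} t *\<^sub>R A t" for t :: real
  define D' where "D' t = indicator {0<..<1} t *\<^sub>R right_deriv A t" for t :: real
  have [measurable]: "A' \<in> borel_measurable borel"
    unfolding A'_def
  proof (rule borel_measurable_continuous_on_indicator)
    show "continuous_on {0<..<1} A"
      by (rule continuous_on_subset[OF pickands_continuous_on[OF A]]) auto
  qed simp
  have "(\<lambda>t. indicator {0<..<1} t *\<^sub>R right_deriv A t) \<in> borel_measurable borel"
    by (rule borel_measurable_restrict_space_iff[THEN iffD1, OF _ borel_measurable_mono_on_fnc[OF mono_on_right_deriv[OF A]]]) simp
  then have [measurable]: "D' \<in> borel_measurable borel" unfolding D'_def .
  have eq: "ev_cond_cdf A x y =
     (if 1 \<le> y then 1
      else if 0 < x \<and> x < 1 \<and> 0 < y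
        then (x * y) powr A' (ln x / ln (x * y)) / x *
          (A' (ln x / ln (x * y)) + (1 - ln x / ln (x * y)) * D' (ln x / ln (x * y)))
      else 0)" for x y
  proof (cases "x \<in> {0<..<1} \<and> y \<in> {0<..<1}")
    case True
    then have "log_ratio x y \<in> {0<..<1}" by (intro log_ratio_in_unit) auto
    then have "A' (log_ratio x y) = A (log_ratio x y)" "D' (log_ratio x y) = right_deriv A (log_ratio x y)"
      unfolding A'_def D'_def by simp_all
    then show ?thesis by (simp add: ev_cond_cdf_def kernel_slope_def log_ratio_def)
  next
    case False
    then show ?thesis unfolding ev_cond_cdf_def by (simp only: greaterThanLessThan_iff not_le) argo
  qed
  show ?thesis unfolding eq by measurable
qed

text \<open>The measure with the given distribution function lives on the real line. Pushing it forward
  along the projection to \<open>[0,1]\<close> moves no mass, as all of it already lies there.\<close>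
definition ev_kernel :: "(real \<Rightarrow> real) \<Rightarrow> real \<Rightarrow> real measure" where
  "ev_kernel A x = distr (interval_measure (ev_cond_cdf A x)) borel_unit (\<lambda>t. max 0 (min 1 t))"

lemma measurable_clamp: "(\<lambda>t::real. max 0 (min 1 t)) \<in> borel \<rightarrow>\<^sub>M borel_unit"
  by (rule measurable_restrict_space2) auto

lemma measure_ev_kernel:
  assumes ev: "extreme_value_copula C A" and y: "y \<in> {0..1}"
  shows "measure (ev_kernel A x) {0..y} = ev_cond_cdf A x y"
proof -
  interpret real_distribution "interval_measure (ev_cond_cdf A x)"
    by (intro real_distribution_interval_measure ev_cond_cdf_mono[OF ev] ev_cond_cdf_right_continuous[OF ev]
        ev_cond_cdf_lim_at_bot ev_cond_cdf_lim_at_top)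
  have Iic: "measure (interval_measure (ev_cond_cdf A x)) {..y} = ev_cond_cdf A x y" for y
    using cdf_interval_measure[of "ev_cond_cdf A x"] ev_cond_cdf_mono[OF ev] ev_cond_cdf_right_continuous[OF ev]
      ev_cond_cdf_lim_at_bot by (metis cdf_def)
  have "measure (ev_kernel A x) {0..y} =
      measure (interval_measure (ev_cond_cdf A x)) ((\<lambda>t. max 0 (min 1 t)) -` {0..y} \<inter> UNIV)"
    unfolding ev_kernel_def using y
    by (subst measure_distr)
       (auto simp: measurable_cong_sets[OF events_eq_borel refl] intro!: measurable_clamp Icc_in_borel_unit)
  also have "\<dots> = ev_cond_cdf A x y"
  proof (cases "y = 1")
    case True
    then have "(\<lambda>t. max 0 (min 1 t)) -` {0..y} \<inter> UNIV = UNIV" by auto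
    then show ?thesis using True prob_space by (simp add: ev_cond_cdf_def)
  next
    case False
    then have "(\<lambda>t. max 0 (min 1 t)) -` {0..y} \<inter> UNIV = {..y}" using y by (auto simp: max_def min_def split: if_splits)
    then show ?thesis using Iic by simp
  qed
  finally show ?thesis .
qed

lemma measurable_ev_kernel:
  assumes ev: "extreme_value_copula C A"
  shows "ev_kernel A \<in> borel_unit \<rightarrow>\<^sub>M prob_algebra borel_unit"
proof -
  have A: "pickands A" using ev by (auto simp: extreme_value_copula_def)
  have [measurable]: "(\<lambda>x. ev_cond_cdf A x y) \<in> borel_measurable borel" for y
    by (rule measurable_ev_cond_cdf[OF A]) simp_all
  have "(\<lambda>x. interval_measure (ev_cond_cdf A x)) \<in> borel \<rightarrow>\<^sub>M prob_algebra borel"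
  proof (rule measurable_prob_algebra_generated)
    show "sets borel = sigma_sets UNIV (range (\<lambda>a::real. {..a}))"
      by (subst borel_eq_atMost) simp
    show "Int_stable (range (\<lambda>a::real. {..a}))" by (auto simp: Int_stable_def intro!: rangeI)
    show "prob_space (interval_measure (ev_cond_cdf A x))" for x
      using real_distribution_interval_measure[of "ev_cond_cdf A x"] ev_cond_cdf_mono[OF ev]
        ev_cond_cdf_right_continuous[OF ev] ev_cond_cdf_lim_at_bot ev_cond_cdf_lim_at_top
      by (simp add: real_distribution_def)
    show "(\<lambda>x. emeasure (interval_measure (ev_cond_cdf A x)) S) \<in> borel_measurable borel"
      if S0: "S \<in> range (\<lambda>a::real. {..a})" for S
    proof -
      obtain a where S: "S = {..a}" using S0 by auto
      have "emeasure (interval_measure (ev_cond_cdf A x)) S = ennreal (ev_cond_cdf A x a)" for x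
        unfolding S by (rule emeasure_interval_measure_Iic[OF ev_cond_cdf_mono[OF ev]
            ev_cond_cdf_right_continuous[OF ev] ev_cond_cdf_lim_at_bot])
      moreover have "(\<lambda>x. ennreal (ev_cond_cdf A x a)) \<in> borel_measurable borel" by measurable
      ultimately show ?thesis by simp
    qed
  qed auto
  from measurable_compose[OF this measurable_distr_prob_space[OF measurable_clamp]]
  show ?thesis unfolding ev_kernel_def by (rule measurable_restrict_space1)
qed

lemma lebesgue_unit_integral:
  "(LINT s|lebesgue_unit. f s) = (LINT s|lborel. indicator {0..1} s * (f s :: real))"
  by (subst integral_restrict_space) auto

lemma ev_copula_eq_integral_ev_cond_cdf:
  assumes ev: "extreme_value_copula C A" and x: "x \<in> {0..1}" and y: "y \<in> {0..1}"
  shows "(LINT s|lebesgue_unit. indicator {0..x} s * ev_cond_cdf A s y) = C x y"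
proof -
  have A: "pickands A" and C: "is_copula C" using ev by (auto simp: extreme_value_copula_def)
  have [measurable]: "(\<lambda>x. ev_cond_cdf A x y) \<in> borel_measurable borel" for y
    by (rule measurable_ev_cond_cdf[OF A]) simp_all
  have m: "C x 0 = 0" "C x 1 = x" using C x by (auto simp: is_copula_def)
  have "(LINT s|lebesgue_unit. indicator {0..x} s * ev_cond_cdf A s y)
      = (LINT s|lborel. indicator {0<..<x} s * ev_cond_cdf A s y)"
    unfolding lebesgue_unit_integral
  proof (rule integral_cong_AE)
    show "AE s in lborel. indicator {0..1} s * (indicator {0..x} s * ev_cond_cdf A s y)
        = indicator {0<..<x} s * ev_cond_cdf A s y"
      using AE_lborel_singleton[of 0] AE_lborel_singleton[of x]
      by eventually_elim (use x in \<open>auto simp: indicator_def\<close>)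
  qed measurable
  also have "\<dots> = C x y"
  proof -
    consider "y = 0" | "y = 1" | "y \<in> {0<..<1}" using y by force
    then show ?thesis
    proof cases
      case 1 then show ?thesis by (simp add: ev_cond_cdf_def m)
    next
      case 2 then show ?thesis using x by (simp add: ev_cond_cdf_def m)
    next
      case 3 then show ?thesis by (rule ev_copula_integral[OF ev x])
    qed
  qed
  finally show ?thesis .
qed

lemma is_markov_kernel_ev_kernel:
  assumes ev: "extreme_value_copula C A"
  shows "is_markov_kernel C (ev_kernel A)"
  by (rule is_markov_kernelI[OF measurable_ev_kernel[OF ev]])
     (simp add: measure_ev_kernel[OF ev] ev_copula_eq_integral_ev_cond_cdf[OF ev])

section \<open>Every Markov kernel has these conditional distribution functions\<close>

lemma borel_measurable_lebesgue_unit: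
  "f \<in> borel_measurable borel \<Longrightarrow> f \<in> borel_measurable lebesgue_unit"
  by (intro measurable_restrict_space1) simp

lemma AE_lebesgue_unit_interior: "AE x in lebesgue_unit. x \<in> {0<..<1}"
proof (subst AE_restrict_space_iff)
  show "AE x in lborel. x \<in> {0..1} \<longrightarrow> x \<in> {0<..<1::real}"
    using AE_lborel_singleton[of 0] AE_lborel_singleton[of 1] by eventually_elim auto
qed simp

lemma AE_lebesgue_unit_not_in_countable:
  "countable N \<Longrightarrow> AE x in lebesgue_unit. x \<notin> N"
  using AE_lborel_not_in_countable[of N] by (subst AE_restrict_space_iff) auto

lemma measure_density_lebesgue_unit:
  assumes f: "integrable lebesgue_unit f" and nn: "\<And>s. s \<in> {0..1} \<Longrightarrow> 0 \<le> f s"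
  shows "finite_measure (density lebesgue_unit (\<lambda>s. ennreal (f s)))"
    and "x \<in> {0..1} \<Longrightarrow> measure (density lebesgue_unit (\<lambda>s. ennreal (f s))) {0..x}
      = (LINT s|lebesgue_unit. indicator {0..x} s * f s)"
proof -
  have sp: "space lebesgue_unit = {0..1}" by (simp add: space_restrict_space)
  have fm: "(\<lambda>s. ennreal (f s)) \<in> borel_measurable lebesgue_unit"
    using borel_measurable_integrable[OF f] by (rule measurable_compose[OF _ measurable_ennreal])
  have em: "emeasure (density lebesgue_unit (\<lambda>s. ennreal (f s))) S
      = ennreal (LINT s|lebesgue_unit. indicator S s * f s)" if S: "S \<in> sets borel_unit" for S
  proof -
    have S': "S \<in> sets lebesgue_unit" using S by (simp add: sets_lebesgue_unit)
    have "emeasure (density lebesgue_unit (\<lambda>s. ennreal (f s))) S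
        = (\<integral>\<^sup>+s. ennreal (f s) * indicator S s \<partial>lebesgue_unit)"
      by (rule emeasure_density[OF fm S'])
    also have "\<dots> = (\<integral>\<^sup>+s. ennreal (indicator S s * f s) \<partial>lebesgue_unit)"
      by (rule nn_integral_cong) (auto simp: indicator_def)
    also have "\<dots> = ennreal (LINT s|lebesgue_unit. indicator S s * f s)"
    proof (rule nn_integral_eq_integral)
      show "integrable lebesgue_unit (\<lambda>s. indicator S s * f s)"
        using integrable_mult_indicator[OF S' f] by simp
      show "AE s in lebesgue_unit. 0 \<le> indicator S s * f s"
        by (rule AE_I2) (use nn sp in \<open>auto intro!: mult_nonneg_nonneg\<close>)
    qed
    finally show ?thesis .
  qed
  show "finite_measure (density lebesgue_unit (\<lambda>s. ennreal (f s)))"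
    by (rule finite_measureI) (use em[OF Icc_in_borel_unit[of 1]] in \<open>simp add: sp\<close>)
  assume x: "x \<in> {0..1}"
  have "0 \<le> (LINT s|lebesgue_unit. indicator {0..x} s * f s)"
    by (rule integral_nonneg_AE, rule AE_I2) (use nn sp in \<open>auto intro!: mult_nonneg_nonneg\<close>)
  then show "measure (density lebesgue_unit (\<lambda>s. ennreal (f s))) {0..x}
      = (LINT s|lebesgue_unit. indicator {0..x} s * f s)"
    using em[OF Icc_in_borel_unit[of x]] x by (simp add: measure_def)
qed

text \<open>Equal integrals over all \<open>{0..x}\<close> make the measures with densities \<open>f\<close> and \<open>g\<close> equal, hence the densities almost everywhere equal.\<close>
lemma AE_lebesgue_unit_eqI:
  assumes f: "integrable lebesgue_unit f" and g: "integrable lebesgue_unit g"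
    and nf: "\<And>s. s \<in> {0..1} \<Longrightarrow> 0 \<le> f s" and ng: "\<And>s. s \<in> {0..1} \<Longrightarrow> (0 :: real) \<le> g s"
    and eq: "\<And>x. x \<in> {0..1} \<Longrightarrow>
      (LINT s|lebesgue_unit. indicator {0..x} s * f s) = (LINT s|lebesgue_unit. indicator {0..x} s * g s)"
  shows "AE s in lebesgue_unit. f s = g s"
proof -
  interpret prob_space lebesgue_unit by (rule prob_space_lebesgue_unit)
  have fm: "(\<lambda>s. ennreal (f s)) \<in> borel_measurable lebesgue_unit"
    using borel_measurable_integrable[OF f] by (rule measurable_compose[OF _ measurable_ennreal])
  have gm: "(\<lambda>s. ennreal (g s)) \<in> borel_measurable lebesgue_unit"
    using borel_measurable_integrable[OF g] by (rule measurable_compose[OF _ measurable_ennreal])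
  have "density lebesgue_unit (\<lambda>s. ennreal (f s)) = density lebesgue_unit (\<lambda>s. ennreal (g s))"
    using measure_density_lebesgue_unit[OF f nf] measure_density_lebesgue_unit[OF g ng] eq
    by (intro measure_eqI_borel_unit) (simp_all add: sets_lebesgue_unit)
  then have "AE s in lebesgue_unit. ennreal (f s) = ennreal (g s)"
    by (rule density_unique[OF fm gm])
  then show ?thesis using AE_space
    by eventually_elim (use nf ng in \<open>auto simp: space_restrict_space\<close>)
qed

lemma integrable_lebesgue_unit_bounded:
  assumes "f \<in> borel_measurable lebesgue_unit" and "\<And>s. s \<in> {0..1} \<Longrightarrow> \<bar>f s\<bar> \<le> (B::real)"
  shows "integrable lebesgue_unit f"
proof -
  interpret prob_space lebesgue_unit by (rule prob_space_lebesgue_unit)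
  show ?thesis
    by (rule integrable_const_bound[of _ B])
       (use assms in \<open>auto simp: space_restrict_space intro!: AE_I2\<close>)
qed

text \<open>The choice in \<open>markov_kernel\<close> is meaningful because the explicit kernel is a witness.\<close>
lemma markov_kernel_is_markov_kernel:
  assumes "extreme_value_copula C A"
  shows "is_markov_kernel C (markov_kernel C)"
  unfolding markov_kernel_def by (rule someI[where P = "is_markov_kernel C", OF is_markov_kernel_ev_kernel[OF assms]])

lemma markov_kernel_measurable:
  assumes ev: "extreme_value_copula C A"
  shows "markov_kernel C \<in> borel_unit \<rightarrow>\<^sub>M prob_algebra borel_unit"
  using markov_kernel_integral(1)[OF _ markov_kernel_is_markov_kernel[OF ev]] ev
  by (simp add: extreme_value_copula_def)

lemma borel_measurable_ev_cond_cdf: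
  assumes "extreme_value_copula C A"
  shows "(\<lambda>x. ev_cond_cdf A x y) \<in> borel_measurable lebesgue_unit"
  using assms by (intro borel_measurable_lebesgue_unit measurable_ev_cond_cdf) (auto simp: extreme_value_copula_def)

text \<open>Both sides integrate over each \<open>{0..x}\<close> to \<open>C x y\<close>.\<close>
lemma AE_markov_kernel_measure:
  assumes ev: "extreme_value_copula C A" and y: "y \<in> {0..1}"
  shows "AE s in lebesgue_unit. measure (markov_kernel C s) {0..y} = ev_cond_cdf A s y"
proof (rule AE_lebesgue_unit_eqI)
  have C: "is_copula C" using ev by (simp add: extreme_value_copula_def)
  show "integrable lebesgue_unit (\<lambda>s. measure (markov_kernel C s) {0..y})"
  proof (rule integrable_lebesgue_unit_bounded)
    show "(\<lambda>s. measure (markov_kernel C s) {0..y}) \<in> borel_measurable lebesgue_unit"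
      using measurable_kernel_measure[OF markov_kernel_measurable[OF ev] Icc_in_borel_unit[of y]] y
      by (simp add: measurable_cong_sets[OF sets_lebesgue_unit refl])
    show "\<bar>measure (markov_kernel C s) {0..y}\<bar> \<le> 1" if "s \<in> {0..1}" for s
      using prob_space.prob_le_1[OF kernel_prob_space(1)[OF markov_kernel_measurable[OF ev] that]] by simp
  qed
  show "integrable lebesgue_unit (\<lambda>s. ev_cond_cdf A s y)"
    by (rule integrable_lebesgue_unit_bounded[where B = 1, OF borel_measurable_ev_cond_cdf[OF ev]])
       (simp add: ev_cond_cdf_bounds[OF ev])
  show "(LINT s|lebesgue_unit. indicator {0..x} s * measure (markov_kernel C s) {0..y})
      = (LINT s|lebesgue_unit. indicator {0..x} s * ev_cond_cdf A s y)" if "x \<in> {0..1}" for x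
    using markov_kernel_integral(2)[OF C markov_kernel_is_markov_kernel[OF ev] that y]
      ev_copula_eq_integral_ev_cond_cdf[OF ev that y] by simp
qed (simp_all add: ev_cond_cdf_bounds[OF ev])

lemma right_continuous_eq_on_Rats:
  fixes f g :: "real \<Rightarrow> real"
  assumes f: "continuous (at_right y) f" and g: "continuous (at_right y) g" and "y < b"
    and eq: "\<And>q. q \<in> \<rat> \<Longrightarrow> y < q \<Longrightarrow> q < b \<Longrightarrow> f q = g q"
  shows "f y = g y"
proof (rule ccontr)
  assume "f y \<noteq> g y"
  moreover have "((\<lambda>z. f z - g z) \<longlongrightarrow> f y - g y) (at_right y)"
    using f g by (intro tendsto_diff) (auto simp: continuous_within)
  ultimately have "eventually (\<lambda>z. f z - g z \<noteq> 0) (at_right y)"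
    by (intro tendsto_imp_eventually_ne) auto
  then obtain c where c: "y < c" "\<And>z. y < z \<Longrightarrow> z < c \<Longrightarrow> f z - g z \<noteq> 0"
    by (auto simp: eventually_at_right_field)
  obtain q where "q \<in> \<rat>" "y < q" "q < min b c"
    using Rats_dense_in_real[of y "min b c"] c \<open>y < b\<close> by auto
  with eq[of q] c(2)[of q] show False by auto
qed

text \<open>One null set serves all \<open>y\<close>: it suffices to discard the null sets of rational \<open>y\<close>, and right
  continuity of both sides extends the equality.\<close>
lemma AE_markov_kernel_cdf:
  assumes ev: "extreme_value_copula C A"
  shows "AE x in lebesgue_unit. \<forall>y. cdf (distr (markov_kernel C x) borel (\<lambda>t. t)) y = ev_cond_cdf A x y"
proof -
  have "countable (\<rat> \<inter> {0..1::real})" by (intro countable_Int1 countable_rat)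
  then have "AE x in lebesgue_unit. \<forall>q\<in>\<rat> \<inter> {0..1}. measure (markov_kernel C x) {0..q} = ev_cond_cdf A x q"
    using AE_markov_kernel_measure[OF ev] by (subst AE_ball_countable) auto
  then show ?thesis using AE_space
  proof eventually_elim
    case (elim x)
    let ?K = "markov_kernel C x" and ?D = "distr (markov_kernel C x) borel (\<lambda>t. t)"
    have x: "x \<in> {0..1}" using elim by (simp add: space_restrict_space)
    note K = kernel_prob_space[OF markov_kernel_measurable[OF ev] x]
    interpret K: prob_space ?K by (rule K)
    have id: "(\<lambda>t. t) \<in> ?K \<rightarrow>\<^sub>M borel"
      unfolding measurable_cong_sets[OF K(2) refl] by (intro measurable_restrict_space1) simp
    interpret D: real_distribution ?D using id by (rule K.real_distribution_distr)
    have cdf: "cdf ?D y = measure ?K ({..y} \<inter> {0..1})" for y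
      unfolding cdf_def using id by (simp add: measure_distr K(3))
    show ?case
    proof
      fix y :: real
      consider "y < 0" | "1 \<le> y" | "0 \<le> y" "y < 1" by linarith
      then show "cdf ?D y = ev_cond_cdf A x y"
      proof cases
        case 1
        then have "{..y} \<inter> {0..1} = {}" by auto
        with 1 show ?thesis by (simp add: cdf ev_cond_cdf_def)
      next
        case 2
        then have "{..y} \<inter> {0..1} = {0..1}" by auto
        with 2 show ?thesis using K.prob_space by (simp add: cdf ev_cond_cdf_def K(3))
      next
        case 3
        show ?thesis
        proof (rule right_continuous_eq_on_Rats[OF D.cdf_is_right_cont ev_cond_cdf_right_continuous[OF ev] 3(2)])
          fix q :: real assume q: "q \<in> \<rat>" "y < q" "q < 1"
          then have "{..q} \<inter> {0..1} = {0..q}" by auto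
          then show "cdf ?D q = ev_cond_cdf A x q" using elim(1) q 3 by (auto simp: cdf)
        qed
      qed
    qed
  qed
qed

section \<open>Continuity points and convergence of the conditional distribution functions\<close>

text \<open>All other ingredients of the formula for the conditional distribution function are continuous and
  positive, so its jumps are exactly those of the right derivative, read off along the
  homeomorphism \<open>log_ratio x\<close>.\<close>
lemma isCont_ev_cond_cdf_iff:
  assumes A: "pickands A" and x: "x \<in> {0<..<1}" and y: "y \<in> {0<..<1}"
  shows "isCont (ev_cond_cdf A x) y \<longleftrightarrow> isCont (right_deriv A) (log_ratio x y)"
proof
  let ?t = "log_ratio x y"
  have t: "?t \<in> {0<..<1}" using x y by (rule log_ratio_in_unit)
  {
    assume D: "isCont (right_deriv A) ?t"
    have tc: "(log_ratio x \<longlongrightarrow> ?t) (at y)"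
      using isCont_log_ratio_right[OF x y] by (simp add: isCont_def)
    note Ac = isCont_tendsto_compose[OF pickands_isCont[OF A t] tc]
    note Dc = isCont_tendsto_compose[OF D tc]
    have xz: "((\<lambda>z. x * z) \<longlongrightarrow> x * y) (at y)" by (rule tendsto_mult[OF tendsto_const tendsto_ident_at])
    have "((\<lambda>z. (x * z) powr A (log_ratio x z) / x * kernel_slope A (log_ratio x z)) \<longlongrightarrow>
        (x * y) powr A ?t / x * kernel_slope A ?t) (at y)"
      unfolding kernel_slope_def
    proof (rule tendsto_mult)
      show "((\<lambda>z. (x * z) powr A (log_ratio x z) / x) \<longlongrightarrow> (x * y) powr A ?t / x) (at y)"
        using x y by (intro tendsto_divide[OF tendsto_powr[OF xz Ac] tendsto_const]) auto
      show "((\<lambda>z. A (log_ratio x z) + (1 - log_ratio x z) * right_deriv A (log_ratio x z)) \<longlongrightarrow>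
          A ?t + (1 - ?t) * right_deriv A ?t) (at y)"
        by (rule tendsto_add[OF Ac tendsto_mult[OF tendsto_diff[OF tendsto_const tc] Dc]])
    qed
    moreover have "eventually (\<lambda>z. (x * z) powr A (log_ratio x z) / x * kernel_slope A (log_ratio x z)
        = ev_cond_cdf A x z) (at y)"
      using eventually_at_in_open'[OF open_greaterThanLessThan y]
      by eventually_elim (use x in \<open>auto simp: ev_cond_cdf_def\<close>)
    ultimately have "(ev_cond_cdf A x \<longlongrightarrow> (x * y) powr A ?t / x * kernel_slope A ?t) (at y)"
      by (rule Lim_transform_eventually)
    then show "isCont (ev_cond_cdf A x) y" using x y by (simp add: isCont_def ev_cond_cdf_def)
  next
    assume F: "isCont (ev_cond_cdf A x) y"
    \<comment> \<open>\<open>Y\<close> inverts \<open>log_ratio x\<close>, so \<open>right_deriv A\<close> can be solved for in the formula for the conditional distribution function.\<close>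
    define Y where "Y t = exp (ln x * ((1 - t) / t))" for t
    have lnx: "ln x < 0" using x by simp
    have Y01: "Y t \<in> {0<..<1}" if "t \<in> {0<..<1}" for t
    proof -
      have "ln x * ((1 - t) / t) < 0" using that lnx by (intro mult_neg_pos) auto
      then show ?thesis by (simp add: Y_def)
    qed
    have Yinv: "log_ratio x (Y t) = t" if "t \<in> {0<..<1}" for t
    proof -
      have "ln x + ln (Y t) = ln x / t" using that by (simp add: Y_def field_simps)
      then show ?thesis using that x lnx Y01[OF that] by (simp add: log_ratio_eq)
    qed
    have Yt: "Y ?t = y"
    proof -
      define L where "L = ln x + ln y"
      have L: "L \<noteq> 0" using x y unfolding L_def by (intro less_imp_neq add_neg_neg) auto
      have t_eq: "?t = ln x / L" using x y by (simp add: log_ratio_eq L_def)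
      have "1 - ?t = ln y / L" using L by (simp add: t_eq L_def field_simps)
      then have "(1 - ?t) / ?t = ln y / ln x" using L lnx by (simp add: t_eq)
      then show ?thesis using y lnx by (simp add: Y_def)
    qed
    have Yc: "isCont Y ?t" unfolding Y_def using t by (intro continuous_intros) auto
    have Fc: "isCont (\<lambda>t. ev_cond_cdf A x (Y t)) ?t"
      using Yc F by (intro isCont_o2[of ?t Y "ev_cond_cdf A x"]) (simp_all add: Yt)
    have "isCont (\<lambda>t. (ev_cond_cdf A x (Y t) * x / (x * Y t) powr A t - A t) / (1 - t)) ?t"
      unfolding isCont_def
    proof (rule tendsto_divide)
      have xY: "((\<lambda>t. x * Y t) \<longlongrightarrow> x * Y ?t) (at ?t)"
        by (rule tendsto_mult[OF tendsto_const Yc[unfolded isCont_def]])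
      have p: "((\<lambda>t. (x * Y t) powr A t) \<longlongrightarrow> (x * Y ?t) powr A ?t) (at ?t)"
        by (rule tendsto_powr[OF xY pickands_isCont[OF A t, unfolded isCont_def]]) (use x y in \<open>simp add: Yt\<close>)
      have p0: "(x * Y ?t) powr A ?t \<noteq> 0" using x y by (simp add: Yt)
      show "((\<lambda>t. ev_cond_cdf A x (Y t) * x / (x * Y t) powr A t - A t) \<longlongrightarrow>
          ev_cond_cdf A x (Y ?t) * x / (x * Y ?t) powr A ?t - A ?t) (at ?t)"
        by (rule tendsto_diff[OF tendsto_divide[OF tendsto_mult[OF Fc[unfolded isCont_def] tendsto_const] p p0]
              pickands_isCont[OF A t, unfolded isCont_def]])
      show "((\<lambda>t. 1 - t) \<longlongrightarrow> 1 - ?t) (at ?t)" by (rule tendsto_diff[OF tendsto_const tendsto_ident_at])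
      show "1 - ?t \<noteq> 0" using t by simp
    qed
    moreover have "eventually (\<lambda>t. (ev_cond_cdf A x (Y t) * x / (x * Y t) powr A t - A t) / (1 - t) = right_deriv A t) (nhds ?t)"
      using eventually_nhds_in_open[OF open_greaterThanLessThan t]
    proof eventually_elim
      case (elim t)
      let ?p = "(x * Y t) powr A t"
      have "?p \<noteq> 0" "x \<noteq> 0" using x Y01[OF elim] by auto
      moreover have "ev_cond_cdf A x (Y t) = ?p / x * kernel_slope A t"
        using x Y01[OF elim] by (simp add: ev_cond_cdf_def Yinv[OF elim])
      ultimately have "ev_cond_cdf A x (Y t) * x / ?p = kernel_slope A t" by simp
      then show ?case using elim by (simp add: kernel_slope_def)
    qed
    ultimately show "isCont (right_deriv A) ?t" by (simp add: isCont_cong)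
  }
qed

text \<open>For fixed \<open>y\<close> the map \<open>x \<mapsto> log_ratio x y\<close> is injective, so it pulls the countably many
  discontinuities of the right derivative back to a countable set. This turns convergence at
  continuity points into convergence for almost every \<open>x\<close>, for each fixed \<open>y\<close>.\<close>
lemma countable_ev_cond_cdf_discontinuities:
  assumes A: "pickands A" and y: "y \<in> {0<..<1}"
  shows "countable {x \<in> {0<..<1}. log_ratio x y \<notin> cont_points_right_deriv A}" (is "countable ?N")
proof (rule countable_image_inj_on)
  have "(\<lambda>x. log_ratio x y) ` ?N \<subseteq> {0<..<1} - cont_points_right_deriv A"
    using log_ratio_in_unit[OF _ y] by auto
  then show "countable ((\<lambda>x. log_ratio x y) ` ?N)"
    using countable_discontinuities_right_deriv[OF A] by (rule countable_subset)
  show "inj_on (\<lambda>x. log_ratio x y) ?N"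
  proof (rule inj_onI)
    fix v w assume *: "v \<in> ?N" "w \<in> ?N" "log_ratio v y = log_ratio w y"
    then show "v = w"
      using log_ratio_strict_antimono_left[OF y, of v w] log_ratio_strict_antimono_left[OF y, of w v]
      by (cases v w rule: linorder_cases) auto
  qed
qed

lemma AE_log_ratio_cont_point:
  assumes A: "pickands A" and y: "y \<in> {0<..<1}"
  shows "AE x in lebesgue_unit. x \<in> {0<..<1} \<and> log_ratio x y \<in> cont_points_right_deriv A"
  using AE_lebesgue_unit_not_in_countable[OF countable_ev_cond_cdf_discontinuities[OF A y]]
    AE_lebesgue_unit_interior by eventually_elim auto

lemma ev_cond_cdf_tendsto:
  assumes x: "x \<in> {0<..<1}" and y: "y \<in> {0<..<1}"
    and A: "(\<lambda>n. An n (log_ratio x y)) \<longlonglongrightarrow> A (log_ratio x y)"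
    and D: "(\<lambda>n. right_deriv (An n) (log_ratio x y)) \<longlonglongrightarrow> right_deriv A (log_ratio x y)"
  shows "(\<lambda>n. ev_cond_cdf (An n) x y) \<longlonglongrightarrow> ev_cond_cdf A x y"
proof -
  have "(\<lambda>n. (x * y) powr An n (log_ratio x y) / x * kernel_slope (An n) (log_ratio x y))
      \<longlonglongrightarrow> (x * y) powr A (log_ratio x y) / x * kernel_slope A (log_ratio x y)"
    unfolding kernel_slope_def
    by (intro tendsto_mult tendsto_divide tendsto_powr tendsto_add tendsto_const A D) (use x y in auto)
  then show ?thesis using x y by (simp add: ev_cond_cdf_def)
qed

text \<open>The inner integral of the metric \<open>D1\<close>, expressed by the explicit conditional distribution
  functions.\<close>
definition ev_distance :: "(real \<Rightarrow> real) \<Rightarrow> (real \<Rightarrow> real) \<Rightarrow> real \<Rightarrow> real" where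
  "ev_distance A B y = (LINT x|lebesgue_unit. \<bar>ev_cond_cdf A x y - ev_cond_cdf B x y\<bar>)"

lemma abs_ev_cond_cdf_diff_le:
  assumes "extreme_value_copula C A" "extreme_value_copula C' B"
  shows "\<bar>ev_cond_cdf A x y - ev_cond_cdf B x y\<bar> \<le> 1"
  using ev_cond_cdf_bounds[OF assms(1), of x y] ev_cond_cdf_bounds[OF assms(2), of x y] by linarith

text \<open>Without this, the outer integral in \<open>D1\<close> could be the default value \<open>0\<close> for trivial reasons.\<close>
lemma borel_measurable_ev_distance:
  assumes "extreme_value_copula C A" "extreme_value_copula C' B"
  shows "ev_distance A B \<in> borel_measurable lebesgue_unit"
proof -
  interpret prob_space lebesgue_unit by (rule prob_space_lebesgue_unit)
  have A: "pickands A" "pickands B" using assms by (auto simp: extreme_value_copula_def)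
  have id: "(\<lambda>t. t) \<in> borel_measurable lebesgue_unit" by (rule borel_measurable_lebesgue_unit) simp
  have [measurable]: "fst \<in> borel_measurable (lebesgue_unit \<Otimes>\<^sub>M lebesgue_unit)"
      "snd \<in> borel_measurable (lebesgue_unit \<Otimes>\<^sub>M lebesgue_unit)"
    using measurable_compose[OF measurable_fst id] measurable_compose[OF measurable_snd id] by auto
  have [measurable]: "(\<lambda>w. ev_cond_cdf D (snd w) (fst w)) \<in> borel_measurable (lebesgue_unit \<Otimes>\<^sub>M lebesgue_unit)"
    if "pickands D" for D by (rule measurable_ev_cond_cdf[OF that]) measurable
  have "(\<lambda>(y, x). \<bar>ev_cond_cdf A x y - ev_cond_cdf B x y\<bar>) \<in> borel_measurable (lebesgue_unit \<Otimes>\<^sub>M lebesgue_unit)"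
    unfolding case_prod_beta using A by measurable
  from borel_measurable_lebesgue_integral[OF this]
  show ?thesis by (simp add: ev_distance_def[abs_def])
qed

lemma ev_distance_bounds:
  assumes "extreme_value_copula C A" "extreme_value_copula C' B"
  shows "0 \<le> ev_distance A B y" "ev_distance A B y \<le> 1"
proof -
  interpret prob_space lebesgue_unit by (rule prob_space_lebesgue_unit)
  show "0 \<le> ev_distance A B y" unfolding ev_distance_def by (rule integral_nonneg_AE) simp
  show "ev_distance A B y \<le> 1" unfolding ev_distance_def
    by (rule integral_le_const)
       (auto simp: abs_ev_cond_cdf_diff_le[OF assms] borel_measurable_ev_cond_cdf[OF assms(1)] borel_measurable_ev_cond_cdf[OF assms(2)]
         intro!: integrable_lebesgue_unit_bounded[where B = 1] borel_measurable_abs borel_measurable_diff)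
qed

lemma D1_eq_integral_ev_distance:
  assumes ev: "extreme_value_copula C A" "extreme_value_copula C' B"
  shows "D1 C C' = (LINT y|lebesgue_unit. ev_distance A B y)"
  unfolding D1_def
proof (rule Bochner_Integration.integral_cong)
  fix y assume "y \<in> space lebesgue_unit"
  then have y: "y \<in> {0..1}" by (simp add: space_restrict_space)
  have km: "(\<lambda>x. measure (markov_kernel C x) {0..y}) \<in> borel_measurable lebesgue_unit"
    if "extreme_value_copula C A" for C A
    using measurable_kernel_measure[OF markov_kernel_measurable[OF that] Icc_in_borel_unit[of y]] y
    by (simp add: measurable_cong_sets[OF sets_lebesgue_unit refl])
  show "(LINT x|lebesgue_unit. \<bar>measure (markov_kernel C x) {0..y} - measure (markov_kernel C' x) {0..y}\<bar>) = ev_distance A B y"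
    unfolding ev_distance_def
  proof (rule integral_cong_AE)
    show "AE x in lebesgue_unit. \<bar>measure (markov_kernel C x) {0..y} - measure (markov_kernel C' x) {0..y}\<bar>
        = \<bar>ev_cond_cdf A x y - ev_cond_cdf B x y\<bar>"
      using AE_markov_kernel_measure[OF ev(1) y] AE_markov_kernel_measure[OF ev(2) y]
      by eventually_elim simp
  qed (intro borel_measurable_abs borel_measurable_diff km[OF ev(1)] km[OF ev(2)]
        borel_measurable_ev_cond_cdf[OF ev(1)] borel_measurable_ev_cond_cdf[OF ev(2)])+
qed simp

section \<open>The implications between the modes of convergence\<close>

text \<open>A copula is the integral of its conditional distribution functions over \<open>{0..x}\<close>.\<close>
lemma copula_diff_le_ev_distance:
  assumes ev: "extreme_value_copula C A" "extreme_value_copula C' B" and x: "x \<in> {0..1}" and y: "y \<in> {0..1}"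
  shows "\<bar>C x y - C' x y\<bar> \<le> ev_distance A B y"
proof -
  have ind: "(indicator {0..x} :: real \<Rightarrow> real) \<in> borel_measurable lebesgue_unit"
    by (rule borel_measurable_lebesgue_unit) simp
  have int: "integrable lebesgue_unit (\<lambda>s. indicator {0..x} s * ev_cond_cdf D s y)"
    if "extreme_value_copula E D" for E D
  proof (rule integrable_lebesgue_unit_bounded)
    show "(\<lambda>s. indicator {0..x} s * ev_cond_cdf D s y) \<in> borel_measurable lebesgue_unit"
      by (rule borel_measurable_times[OF ind borel_measurable_ev_cond_cdf[OF that]])
    show "\<bar>indicator {0..x} s * ev_cond_cdf D s y\<bar> \<le> 1" for s
      using ev_cond_cdf_bounds[OF that, of s y] by (simp add: indicator_def)
  qed
  have diff: "C x y - C' x y = (LINT s|lebesgue_unit. indicator {0..x} s * ev_cond_cdf A s y - indicator {0..x} s * ev_cond_cdf B s y)"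
    unfolding ev_copula_eq_integral_ev_cond_cdf[OF ev(1) x y, symmetric] ev_copula_eq_integral_ev_cond_cdf[OF ev(2) x y, symmetric]
    by (rule Bochner_Integration.integral_diff[OF int[OF ev(1)] int[OF ev(2)], symmetric])
  have "\<bar>C x y - C' x y\<bar> \<le> (LINT s|lebesgue_unit. \<bar>indicator {0..x} s * ev_cond_cdf A s y - indicator {0..x} s * ev_cond_cdf B s y\<bar>)"
    unfolding diff by (rule integral_abs_bound)
  also have "\<dots> \<le> ev_distance A B y" unfolding ev_distance_def
  proof (rule integral_mono)
    show "integrable lebesgue_unit (\<lambda>s. \<bar>indicator {0..x} s * ev_cond_cdf A s y - indicator {0..x} s * ev_cond_cdf B s y\<bar>)"
      by (intro integrable_abs Bochner_Integration.integrable_diff int[OF ev(1)] int[OF ev(2)])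
    show "integrable lebesgue_unit (\<lambda>s. \<bar>ev_cond_cdf A s y - ev_cond_cdf B s y\<bar>)"
    proof (rule integrable_lebesgue_unit_bounded)
      show "(\<lambda>s. \<bar>ev_cond_cdf A s y - ev_cond_cdf B s y\<bar>) \<in> borel_measurable lebesgue_unit"
        by (intro borel_measurable_abs borel_measurable_diff borel_measurable_ev_cond_cdf[OF ev(1)] borel_measurable_ev_cond_cdf[OF ev(2)])
      show "\<bar>\<bar>ev_cond_cdf A s y - ev_cond_cdf B s y\<bar>\<bar> \<le> 1" for s
        using abs_ev_cond_cdf_diff_le[OF ev] by simp
    qed
  qed (simp add: indicator_def)
  finally show ?thesis .
qed

text \<open>A quantitative form of the fact that small integrals of nonnegative functions with a common
  Lipschitz constant force small values. It upgrades convergence in mean to pointwise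
  convergence.\<close>
lemma square_le_integral_of_lipschitz:
  fixes \<psi> :: "real \<Rightarrow> real"
  assumes b: "\<And>y. y \<in> {0..1} \<Longrightarrow> 0 \<le> \<psi> y \<and> \<psi> y \<le> 1"
    and lip: "\<And>y z. y \<in> {0..1} \<Longrightarrow> z \<in> {0..1} \<Longrightarrow> \<bar>\<psi> y - \<psi> z\<bar> \<le> 2 * \<bar>y - z\<bar>"
    and y: "y \<in> {0..1}"
    and m: "\<psi> \<in> borel_measurable lebesgue_unit"
  shows "(\<psi> y)\<^sup>2 \<le> 8 * (LINT z|lebesgue_unit. \<psi> z)"
proof -
  \<comment> \<open>On an interval of length \<open>r\<close> with endpoint \<open>y\<close> the Lipschitz bound leaves \<open>\<psi> \<ge> \<psi> y - 2 * r = 2 * r\<close>; as \<open>r \<le> 1/4\<close>, it fits into \<open>[0,1]\<close> on the side of \<open>y\<close> facing the centre.\<close>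
  define r where "r = \<psi> y / 4"
  have r: "0 \<le> r" "r \<le> 1/4" using b[OF y] by (auto simp: r_def)
  define a where "a = (if y \<le> 1/2 then y else y - r)"
  have a: "0 \<le> a" "a + r \<le> 1" "a \<le> y" "y \<le> a + r" using y r by (auto simp: a_def)
  have iJ: "integrable lebesgue_unit (\<lambda>z. indicator {a..a + r} z * (2 * r))"
    by (rule integrable_lebesgue_unit_bounded[where B = "2 * r"])
       (use r in \<open>auto intro!: borel_measurable_lebesgue_unit simp: indicator_def\<close>)
  have "(LINT z|lebesgue_unit. indicator {a..a + r} z * (2 * r)) = r * (2 * r)"
  proof -
    have "(LINT z|lebesgue_unit. indicator {a..a + r} z * (2 * r))
        = (LINT z|lborel. indicator {a..a + r} z * (2 * r))"
      unfolding lebesgue_unit_integral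
      by (rule Bochner_Integration.integral_cong) (use a in \<open>auto simp: indicator_def\<close>)
    then show ?thesis using r by simp
  qed
  moreover have "(LINT z|lebesgue_unit. indicator {a..a + r} z * (2 * r)) \<le> (LINT z|lebesgue_unit. \<psi> z)"
  proof (rule integral_mono[OF iJ])
    show "integrable lebesgue_unit \<psi>"
      by (rule integrable_lebesgue_unit_bounded[where B = 1, OF m]) (simp add: b abs_of_nonneg)
    fix z assume "z \<in> space lebesgue_unit"
    then have z: "z \<in> {0..1}" by (simp add: space_restrict_space)
    show "indicator {a..a + r} z * (2 * r) \<le> \<psi> z"
    proof (cases "z \<in> {a..a + r}")
      case True
      then have "\<bar>y - z\<bar> \<le> r" using a by auto
      then have "\<bar>\<psi> y - \<psi> z\<bar> \<le> 2 * r" using lip[OF y z] by simp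
      then have "\<psi> y - \<psi> z \<le> 2 * r" by (rule abs_le_D1)
      then show ?thesis using True by (simp add: r_def)
    qed (use b[OF z] in auto)
  qed
  ultimately have "r * (2 * r) \<le> (LINT z|lebesgue_unit. \<psi> z)" by metis
  then show ?thesis by (simp add: r_def power2_eq_square)
qed

text \<open>Every argument \<open>t\<close> of the dependence function is attained on the curve \<open>x * y = exp (-1)\<close>, where the
  copula is \<open>exp (- A t)\<close>.\<close>
lemma pickands_tendsto_of_copula_tendsto:
  assumes ev: "extreme_value_copula C A" and evn: "\<And>n. extreme_value_copula (Cn n) (An n)"
    and conv: "\<And>x y. x \<in> {0..1} \<Longrightarrow> y \<in> {0..1} \<Longrightarrow> (\<lambda>n. Cn n x y) \<longlonglongrightarrow> C x y"
    and t: "t \<in> {0..1}"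
  shows "(\<lambda>n. An n t) \<longlonglongrightarrow> A t"
proof (cases "t \<in> {0<..<1}")
  case True
  \<comment> \<open>With these points \<open>x * y = exp (-1)\<close> and \<open>ln x / ln (x * y) = t\<close>.\<close>
  define x where "x = exp (- t)"
  define y where "y = exp (- (1 - t))"
  have xy: "x \<in> {0<..<1}" "y \<in> {0<..<1}" using True by (auto simp: x_def y_def)
  have prod: "x * y = exp (-1)" by (simp add: x_def y_def flip: exp_add)
  have E: "E x y = exp (- B t)" if "extreme_value_copula E B" for E B
    using that xy by (simp add: extreme_value_copula_def prod powr_def) (simp add: x_def)
  have "(\<lambda>n. Cn n x y) \<longlonglongrightarrow> C x y" by (rule conv) (use xy in auto)
  then have "(\<lambda>n. exp (- An n t)) \<longlonglongrightarrow> exp (- A t)" by (simp add: E[OF ev] E[OF evn])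
  then have "(\<lambda>n. ln (exp (- An n t))) \<longlonglongrightarrow> ln (exp (- A t))" by (rule tendsto_ln) simp
  then have "(\<lambda>n. - An n t) \<longlonglongrightarrow> - A t" by (simp only: ln_exp)
  from tendsto_minus[OF this] show ?thesis by (simp only: minus_minus)
next
  case False
  then have "t = 0 \<or> t = 1" using t by auto
  moreover have "pickands A" "pickands (An n)" for n using ev evn[of n] by (auto simp: extreme_value_copula_def)
  ultimately show ?thesis by (auto simp: pickandsD)
qed

lemma copula_boundary:
  assumes "is_copula C" "x \<in> {0..1}" "y \<in> {0..1}" "\<not> (x \<in> {0<..<1} \<and> y \<in> {0<..<1})"
  shows "C x y = (if x = 0 \<or> y = 0 then 0 else if x = 1 then y else x)"
proof -
  have "x = 0 \<or> x = 1 \<or> y = 0 \<or> y = 1" using assms by auto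
  then show ?thesis using assms by (auto simp: is_copula_def)
qed

lemma copula_tendsto_of_pickands_tendsto:
  assumes ev: "extreme_value_copula C A" and evn: "\<And>n. extreme_value_copula (Cn n) (An n)"
    and conv: "\<And>t. t \<in> {0..1} \<Longrightarrow> (\<lambda>n. An n t) \<longlonglongrightarrow> A t"
    and x: "x \<in> {0..1}" and y: "y \<in> {0..1}"
  shows "(\<lambda>n. Cn n x y) \<longlonglongrightarrow> C x y"
proof (cases "x \<in> {0<..<1} \<and> y \<in> {0<..<1}")
  case True
  have "log_ratio x y \<in> {0<..<1}" using True by (intro log_ratio_in_unit) auto
  then have "(\<lambda>n. An n (log_ratio x y)) \<longlonglongrightarrow> A (log_ratio x y)" by (intro conv) auto
  then have "(\<lambda>n. (x * y) powr An n (log_ratio x y)) \<longlonglongrightarrow> (x * y) powr A (log_ratio x y)"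
    using True by (intro tendsto_powr tendsto_const) auto
  then show ?thesis using True ev evn by (simp add: extreme_value_copula_def log_ratio_def)
next
  case False
  have "is_copula C" "is_copula (Cn n)" for n using ev evn[of n] by (auto simp: extreme_value_copula_def)
  then show ?thesis by (simp add: copula_boundary[OF _ x y False])
qed

text \<open>Dominated convergence twice: for fixed \<open>y\<close> the integrand tends to \<open>0\<close> for all but countably many
  \<open>x\<close>, so the inner integrals tend to \<open>0\<close>; these are bounded by \<open>1\<close>.\<close>
lemma D1_tendsto_0:
  assumes ev: "extreme_value_copula C A" and evn: "\<And>n. extreme_value_copula (Cn n) (An n)"
    and conv: "\<And>t. t \<in> {0..1} \<Longrightarrow> (\<lambda>n. An n t) \<longlonglongrightarrow> A t"
    and convD: "\<And>t. t \<in> cont_points_right_deriv A \<Longrightarrow> (\<lambda>n. right_deriv (An n) t) \<longlonglongrightarrow> right_deriv A t"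
  shows "(\<lambda>n. D1 (Cn n) C) \<longlonglongrightarrow> 0"
proof -
  interpret prob_space lebesgue_unit by (rule prob_space_lebesgue_unit)
  have A: "pickands A" using ev by (simp add: extreme_value_copula_def)
  have inner: "(\<lambda>n. ev_distance (An n) A y) \<longlonglongrightarrow> 0" if y: "y \<in> {0<..<1}" for y
  proof -
    have "(\<lambda>n. ev_distance (An n) A y) \<longlonglongrightarrow> (LINT x|lebesgue_unit. 0)"
      unfolding ev_distance_def
    proof (rule integral_dominated_convergence[where w = "\<lambda>_. 1"])
      show "(\<lambda>x. \<bar>ev_cond_cdf (An n) x y - ev_cond_cdf A x y\<bar>) \<in> borel_measurable lebesgue_unit" for n
        by (intro borel_measurable_abs borel_measurable_diff borel_measurable_ev_cond_cdf[OF ev] borel_measurable_ev_cond_cdf[OF evn])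
      show "AE x in lebesgue_unit. (\<lambda>n. \<bar>ev_cond_cdf (An n) x y - ev_cond_cdf A x y\<bar>) \<longlonglongrightarrow> 0"
        using AE_log_ratio_cont_point[OF A y]
      proof eventually_elim
        case (elim x)
        have t: "log_ratio x y \<in> {0..1}" using elim by (auto simp: cont_points_right_deriv_def)
        have "(\<lambda>n. ev_cond_cdf (An n) x y) \<longlonglongrightarrow> ev_cond_cdf A x y"
          using elim by (intro ev_cond_cdf_tendsto y conv[OF t] convD) auto
        then have "(\<lambda>n. ev_cond_cdf (An n) x y - ev_cond_cdf A x y) \<longlonglongrightarrow> 0" by (simp add: LIM_zero_iff)
        then show ?case by (rule tendsto_rabs_zero)
      qed
      show "AE x in lebesgue_unit. norm \<bar>ev_cond_cdf (An n) x y - ev_cond_cdf A x y\<bar> \<le> 1" for n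
        using abs_ev_cond_cdf_diff_le[OF evn ev] by simp
    qed auto
    then show ?thesis by simp
  qed
  have "(\<lambda>n. LINT y|lebesgue_unit. ev_distance (An n) A y) \<longlonglongrightarrow> (LINT y|lebesgue_unit. 0)"
  proof (rule integral_dominated_convergence[where w = "\<lambda>_. 1"])
    show "ev_distance (An n) A \<in> borel_measurable lebesgue_unit" for n
      by (rule borel_measurable_ev_distance[OF evn ev])
    show "AE y in lebesgue_unit. (\<lambda>n. ev_distance (An n) A y) \<longlonglongrightarrow> 0"
      using AE_lebesgue_unit_interior by eventually_elim (rule inner)
    show "AE y in lebesgue_unit. norm (ev_distance (An n) A y) \<le> 1" for n
      using ev_distance_bounds[OF evn ev] by simp
  qed auto
  then show ?thesis by (simp add: D1_eq_integral_ev_distance[OF evn ev])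
qed

text \<open>At a continuity point \<open>y\<close> of the limiting conditional distribution function, \<open>log_ratio x y\<close> is a
  continuity point of the right derivative.\<close>
lemma weak_cond_conv_of_pickands_tendsto:
  assumes ev: "extreme_value_copula C A" and evn: "\<And>n. extreme_value_copula (Cn n) (An n)"
    and conv: "\<And>t. t \<in> {0..1} \<Longrightarrow> (\<lambda>n. An n t) \<longlonglongrightarrow> A t"
    and convD: "\<And>t. t \<in> cont_points_right_deriv A \<Longrightarrow> (\<lambda>n. right_deriv (An n) t) \<longlonglongrightarrow> right_deriv A t"
  shows "weak_cond_conv Cn C"
proof -
  have A: "pickands A" using ev by (simp add: extreme_value_copula_def)
  have "AE x in lebesgue_unit. \<forall>n. \<forall>y. cdf (distr (markov_kernel (Cn n) x) borel (\<lambda>t. t)) y = ev_cond_cdf (An n) x y"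
    using AE_markov_kernel_cdf[OF evn] by (simp add: AE_all_countable)
  then show ?thesis
    using AE_markov_kernel_cdf[OF ev] AE_lebesgue_unit_interior
    unfolding weak_cond_conv_def
  proof eventually_elim
    case (elim x)
    have "(\<lambda>n. ev_cond_cdf (An n) x y) \<longlonglongrightarrow> ev_cond_cdf A x y" if c: "isCont (ev_cond_cdf A x) y" for y
    proof (cases "y \<in> {0<..<1}")
      case True
      have "log_ratio x y \<in> {0<..<1}" using elim(3) True by (rule log_ratio_in_unit)
      moreover from this have "log_ratio x y \<in> cont_points_right_deriv A"
        using c isCont_ev_cond_cdf_iff[OF A elim(3) True] by (simp add: cont_points_right_deriv_def)
      ultimately show ?thesis using elim(3) True by (intro ev_cond_cdf_tendsto conv convD) auto
    qed (auto simp: ev_cond_cdf_def)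
    moreover have "cdf (distr (markov_kernel C x) borel (\<lambda>t. t)) = ev_cond_cdf A x" using elim(2) by auto
    ultimately show ?case
      using elim(1) by (simp add: weak_conv_m_def weak_conv_def)
  qed
qed

text \<open>For fixed \<open>x\<close> the distance of the two copulas is \<open>2\<close>-Lipschitz in \<open>y\<close> and its integral is at most
  their \<open>D1\<close> distance.\<close>
lemma copula_tendsto_of_D1_tendsto_0:
  assumes ev: "extreme_value_copula C A" and evn: "\<And>n. extreme_value_copula (Cn n) (An n)"
    and D1: "(\<lambda>n. D1 (Cn n) C) \<longlonglongrightarrow> 0" and x: "x \<in> {0..1}" and y: "y \<in> {0..1}"
  shows "(\<lambda>n. Cn n x y) \<longlonglongrightarrow> C x y"
proof -
  have C: "is_copula C" and Cn: "is_copula (Cn n)" for n using ev evn[of n] by (auto simp: extreme_value_copula_def)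
  have "\<bar>Cn n x y - C x y\<bar> \<le> sqrt (8 * D1 (Cn n) C)" for n
  proof (rule real_le_rsqrt)
    define \<psi> where "\<psi> z = \<bar>Cn n x z - C x z\<bar>" for z
    have lip: "\<bar>\<psi> w - \<psi> z\<bar> \<le> 2 * \<bar>w - z\<bar>" if "w \<in> {0..1}" "z \<in> {0..1}" for w z
    proof -
      have "\<bar>\<psi> w - \<psi> z\<bar> \<le> \<bar>(Cn n x w - C x w) - (Cn n x z - C x z)\<bar>"
        unfolding \<psi>_def by (rule abs_triangle_ineq3)
      also have "\<dots> = \<bar>(Cn n x w - Cn n x z) - (C x w - C x z)\<bar>" by (simp add: algebra_simps)
      also have "\<dots> \<le> \<bar>Cn n x w - Cn n x z\<bar> + \<bar>C x w - C x z\<bar>" by (rule abs_triangle_ineq4)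
      also have "\<dots> \<le> 2 * \<bar>w - z\<bar>"
        using copula_lipschitz[OF C x x that] copula_lipschitz[OF Cn x x that, of n] by simp
      finally show ?thesis .
    qed
    have bd: "0 \<le> \<psi> z \<and> \<psi> z \<le> 1" if "z \<in> {0..1}" for z
      using copula_bounds[OF C x that] copula_bounds[OF Cn x that, of n] x unfolding \<psi>_def by auto
    have "continuous_on {0..1} \<psi>"
    proof (rule continuous_onI)
      fix w e :: real assume w: "w \<in> {0..1}" and e: "0 < e"
      have "dist (\<psi> z) (\<psi> w) \<le> e" if "z \<in> {0..1}" "dist z w < e / 2" for z
        using lip[OF that(1) w] that(2) by (simp add: dist_real_def)
      with e show "\<exists>d>0. \<forall>z\<in>{0..1}. dist z w < d \<longrightarrow> dist (\<psi> z) (\<psi> w) \<le> e"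
        by (intro exI[of _ "e / 2"]) auto
    qed
    then have "\<psi> \<in> borel_measurable borel_unit" by (rule borel_measurable_continuous_on_restrict)
    then have m: "\<psi> \<in> borel_measurable lebesgue_unit"
      by (simp add: measurable_cong_sets[OF sets_lebesgue_unit refl])
    have sq: "(\<psi> y)\<^sup>2 \<le> 8 * (LINT z|lebesgue_unit. \<psi> z)"
      by (rule square_le_integral_of_lipschitz[OF bd lip y m])
    have "(LINT z|lebesgue_unit. \<psi> z) \<le> D1 (Cn n) C"
      unfolding D1_eq_integral_ev_distance[OF evn ev]
    proof (rule integral_mono)
      show "integrable lebesgue_unit \<psi>"
        by (rule integrable_lebesgue_unit_bounded[where B = 1, OF m]) (simp add: bd abs_of_nonneg)
      show "integrable lebesgue_unit (ev_distance (An n) A)"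
        by (rule integrable_lebesgue_unit_bounded[where B = 1, OF borel_measurable_ev_distance[OF evn ev]])
           (simp add: ev_distance_bounds[OF evn ev])
      show "\<psi> z \<le> ev_distance (An n) A z" if "z \<in> space lebesgue_unit" for z
        unfolding \<psi>_def using that by (intro copula_diff_le_ev_distance[OF evn ev x]) (simp add: space_restrict_space)
    qed
    with sq have "(\<psi> y)\<^sup>2 \<le> 8 * D1 (Cn n) C" by simp
    then show "\<bar>Cn n x y - C x y\<bar>\<^sup>2 \<le> 8 * D1 (Cn n) C" by (simp only: \<psi>_def)
  qed
  then have le: "eventually (\<lambda>n. \<bar>Cn n x y - C x y\<bar> \<le> sqrt (8 * D1 (Cn n) C)) sequentially"
    by (intro always_eventually allI)
  have "(\<lambda>n. sqrt (8 * D1 (Cn n) C)) \<longlonglongrightarrow> sqrt (8 * 0)" by (intro tendsto_intros D1)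
  then have up: "(\<lambda>n. sqrt (8 * D1 (Cn n) C)) \<longlonglongrightarrow> 0" by simp
  have "(\<lambda>n. \<bar>Cn n x y - C x y\<bar>) \<longlonglongrightarrow> 0"
    by (rule tendsto_sandwich[OF _ le tendsto_const up]) simp
  then show ?thesis by (simp add: LIM_zero_iff tendsto_rabs_zero_iff)
qed

text \<open>For fixed \<open>y\<close>, almost every \<open>x\<close> has \<open>y\<close> as a continuity point of its limiting conditional
  distribution function, so weak convergence gives convergence there, and the copulas follow by
  integration.\<close>
lemma copula_tendsto_of_weak_cond_conv:
  assumes ev: "extreme_value_copula C A" and evn: "\<And>n. extreme_value_copula (Cn n) (An n)"
    and wcc: "weak_cond_conv Cn C" and x: "x \<in> {0..1}" and y: "y \<in> {0..1}"
  shows "(\<lambda>n. Cn n x y) \<longlonglongrightarrow> C x y"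
proof (cases "y \<in> {0<..<1}")
  case True
  interpret prob_space lebesgue_unit by (rule prob_space_lebesgue_unit)
  have A: "pickands A" using ev by (simp add: extreme_value_copula_def)
  have ind: "(indicator {0..x} :: real \<Rightarrow> real) \<in> borel_measurable lebesgue_unit"
    by (rule borel_measurable_lebesgue_unit) simp
  have "AE s in lebesgue_unit. \<forall>n. \<forall>y. cdf (distr (markov_kernel (Cn n) s) borel (\<lambda>t. t)) y = ev_cond_cdf (An n) s y"
    using AE_markov_kernel_cdf[OF evn] by (simp add: AE_all_countable)
  then have conv: "AE s in lebesgue_unit. (\<lambda>n. ev_cond_cdf (An n) s y) \<longlonglongrightarrow> ev_cond_cdf A s y"
    using AE_markov_kernel_cdf[OF ev] AE_log_ratio_cont_point[OF A True] wcc[unfolded weak_cond_conv_def]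
  proof eventually_elim
    case (elim s)
    have "isCont (ev_cond_cdf A s) y"
      using elim(3) isCont_ev_cond_cdf_iff[OF A _ True, of s] by (simp add: cont_points_right_deriv_def)
    moreover have "cdf (distr (markov_kernel C s) borel (\<lambda>t. t)) = ev_cond_cdf A s" using elim(2) by auto
    ultimately show ?case using elim(1,4) by (simp add: weak_conv_m_def weak_conv_def)
  qed
  have "(\<lambda>n. LINT s|lebesgue_unit. indicator {0..x} s * ev_cond_cdf (An n) s y)
      \<longlonglongrightarrow> (LINT s|lebesgue_unit. indicator {0..x} s * ev_cond_cdf A s y)"
  proof (rule integral_dominated_convergence[where w = "\<lambda>_. 1"])
    show "AE s in lebesgue_unit. (\<lambda>n. indicator {0..x} s * ev_cond_cdf (An n) s y)
        \<longlonglongrightarrow> indicator {0..x} s * ev_cond_cdf A s y"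
      using conv by eventually_elim (rule tendsto_mult_left)
    show "AE s in lebesgue_unit. norm (indicator {0..x} s * ev_cond_cdf (An n) s y) \<le> 1" for n
      by (rule AE_I2) (auto simp: indicator_def ev_cond_cdf_bounds[OF evn])
    show "(\<lambda>s. indicator {0..x} s * ev_cond_cdf A s y) \<in> borel_measurable lebesgue_unit"
      by (rule borel_measurable_times[OF ind borel_measurable_ev_cond_cdf[OF ev]])
    show "(\<lambda>s. indicator {0..x} s * ev_cond_cdf (An n) s y) \<in> borel_measurable lebesgue_unit" for n
      by (rule borel_measurable_times[OF ind borel_measurable_ev_cond_cdf[OF evn]])
  qed simp
  then show ?thesis
    using ev_copula_eq_integral_ev_cond_cdf[OF ev x y] ev_copula_eq_integral_ev_cond_cdf[OF evn x y] by simp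
next
  case False
  have "is_copula C" "is_copula (Cn n)" for n using ev evn[of n] by (auto simp: extreme_value_copula_def)
  then show ?thesis using False by (simp add: copula_boundary[OF _ x y])
qed

theorem theorem5p1:
  fixes C :: "real \<Rightarrow> real \<Rightarrow> real" and Cn :: "nat \<Rightarrow> real \<Rightarrow> real \<Rightarrow> real"
    and A :: "real \<Rightarrow> real" and An :: "nat \<Rightarrow> real \<Rightarrow> real"
  assumes "extreme_value_copula C A"
    and "\<And>n. extreme_value_copula (Cn n) (An n)"
  defines "a \<equiv> (\<forall>x\<in>{0..1}. \<forall>y\<in>{0..1}. (\<lambda>n. Cn n x y) \<longlonglongrightarrow> C x y)"
    and "b \<equiv> (\<forall>x\<in>{0..1}. (\<lambda>n. An n x) \<longlonglongrightarrow> A x)"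
    and "c \<equiv> (\<forall>x\<in>cont_points_right_deriv A. (\<lambda>n. right_deriv (An n) x) \<longlonglongrightarrow> right_deriv A x)"
    and "d \<equiv> (\<lambda>n. D1 (Cn n) C) \<longlonglongrightarrow> 0"
    and "e \<equiv> weak_cond_conv Cn C"
  shows "(a \<longleftrightarrow> b) \<and> (b \<longleftrightarrow> c) \<and> (c \<longleftrightarrow> d) \<and> (d \<longleftrightarrow> e)"
proof -
  note ev = assms(1) and evn = assms(2)
  have A: "pickands A" and An: "pickands (An n)" for n
    using ev evn[of n] by (auto simp: extreme_value_copula_def)
  have ab: "b" if "a"
    using that pickands_tendsto_of_copula_tendsto[where Cn = Cn and An = An, OF ev evn] unfolding a_def b_def by blast
  have bc: "c" if "b"
    using that right_deriv_tendsto_of_pickands_tendsto[where An = An, OF A An] unfolding b_def c_def by blast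
  have cb: "b" if "c"
    using that pickands_tendsto_of_right_deriv_tendsto[where An = An, OF A An] unfolding b_def c_def by blast
  have ba: "a" if "b"
    using that copula_tendsto_of_pickands_tendsto[where Cn = Cn and An = An, OF ev evn] unfolding a_def b_def by blast
  have cd: "d" if "c"
    using that cb[OF that] D1_tendsto_0[where Cn = Cn and An = An, OF ev evn] unfolding b_def c_def d_def by blast
  have ce: "e" if "c"
    using that cb[OF that] weak_cond_conv_of_pickands_tendsto[where Cn = Cn and An = An, OF ev evn] unfolding b_def c_def e_def by blast
  have da: "a" if "d"
    using that copula_tendsto_of_D1_tendsto_0[where Cn = Cn and An = An, OF ev evn] unfolding a_def d_def by blast
  have ea: "a" if "e"
    using that copula_tendsto_of_weak_cond_conv[where Cn = Cn and An = An, OF ev evn] unfolding a_def e_def by blast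
  show ?thesis using ab bc cb ba cd ce da ea by blast
qed

end
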